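(* Let $a=(a_1,\dots,a_n)\in\mathbb{R}^n$ with $a_i>0$ for all $i$, and let $0<\kappa<1$. (i) If $1<p<\infty$ and $w\in A_p$, then the anisotropic maximal operator $M$ is bounded on $L_{p,\kappa,a}(w)$; that is, there is a constant $C>0$ such that $\|Mf\|_{L_{p,\kappa,a}(w)}\le C\,\|f\|_{L_{p,\kappa,a}(w)}$ for all $f\in L_{p,\kappa,a}(w)$. (ii) If $p=1$ and $w\in A_1$, then there is a constant $C>0$ such that for all $f\in L_{1,\kappa,a}(w)$, all $t>0$ and every parallelepiped $E$, $$w\big(\{x\in E: Mf(x)>t\}\big)\le \frac{C}{t}\,\|f\|_{L_{1,\kappa,a}(w)}\,w(E)^{\kappa}.$$
   Context: Fix $a=(a_1,\dots,a_n)$ with all $a_i>0$. For $x\in\mathbb{R}^n$ and $t>0$ put $E(x,t)=\{y\in\mathbb{R}^n: |y_i-x_i|\le t^{a_i},\ i=1,\dots,n\}$. "Parallelepiped" means a set of the form $E=E(x,t)$ with $x\in\mathbb{R}^n$, $t>0$; $|E|$ is its Lebesgue measure. A weight is a locally integrable function $w$ on $\mathbb{R}^n$ with values in $(0,\infty)$ almost everywhere; $w(S)=\int_S w(x)\,dx$ for measurable $S$. For $1\le p<\infty$, $0\le\kappa<1$ and a weight $w$, the weighted anisotropic Morrey space $L_{p,\kappa,a}(w)$ consists of the measurable functions $f$, locally integrable with respect to $w(x)\,dx$, such that $$\|f\|_{L_{p,\kappa,a}(w)}=\sup_{E}\left(\frac{1}{w(E)^{\kappa}}\int_E |f(x)|^p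 w(x)\,dx\right)^{1/p}<\infty,$$ the supremum being over all parallelepipeds $E$. The anisotropic maximal function is $$Mf(x)=\sup_{t>0}\frac{1}{|E(x,t)|}\int_{E(x,t)}|f(y)|\,dy .$$ Muckenhoupt classes (with respect to parallelepipeds): for $1<p<\infty$, with $\frac1p+\frac1{p'}=1$, a weight $w$ is in $A_p$ if there is a constant $C>1$ such that for every parallelepiped $E$ $$\left(\frac{1}{|E|}\int_E w(x)\,dx\right)\left(\frac{1}{|E|}\int_E w(x)^{1-p'}\,dx\right)^{p-1}\le C .$$ A weight $w$ is in $A_1$ if there is a constant $C>1$ such that $Mw(x)\le C\,w(x)$ for almost every $x$. *)

theory Defs
  imports "HOL-Analysis.Analysis"
begin

definition parallelepiped :: "real^'n \<Rightarrow> real^'n \<Rightarrow> real \<Rightarrow> (real^'n) set" where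
  "parallelepiped a x t = {y. \<forall>i. \<bar>y $ i - x $ i\<bar> \<le> t powr (a $ i)}"

definition parallelepipeds :: "real^'n \<Rightarrow> (real^'n) set set" where
  "parallelepipeds a = {parallelepiped a x t |x t. t > 0}"

text \<open>Powers of elements of \<open>[0,\<infinity>]\<close>, meant for exponents \<open>r > 0\<close>
  (so that \<open>0\<close> and \<open>\<infinity>\<close> are sent to themselves).\<close>

definition ennpowr :: "ennreal \<Rightarrow> real \<Rightarrow> ennreal" where
  "ennpowr x r = (if x = \<infinity> then \<infinity> else ennreal (enn2real x powr r))"

definition weight :: "(real^'n \<Rightarrow> real) \<Rightarrow> bool" where
  "weight w \<longleftrightarrow> w \<in> borel_measurable lebesgue \<and>
    (\<forall>K. compact K \<longrightarrow> set_integrable lebesgue K w) \<and> (AE x in lebesgue. 0 < w x)"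

definition wmeasure :: "(real^'n \<Rightarrow> real) \<Rightarrow> (real^'n) set \<Rightarrow> ennreal" where
  "wmeasure w S = (\<integral>\<^sup>+x\<in>S. ennreal (w x) \<partial>lebesgue)"

text \<open>Functions take extended real values, because the maximal function may be infinite
  at some points; \<open>emod f\<close> is the modulus of \<open>f\<close> as a function into \<open>[0,\<infinity>]\<close>.\<close>

definition emod :: "('a \<Rightarrow> ereal) \<Rightarrow> 'a \<Rightarrow> ennreal" where
  "emod f x = e2ennreal \<bar>f x\<bar>"

definition morrey_norm ::
  "real^'n \<Rightarrow> real \<Rightarrow> real \<Rightarrow> (real^'n \<Rightarrow> real) \<Rightarrow> (real^'n \<Rightarrow> ereal) \<Rightarrow> ennreal" where
  "morrey_norm a p \<kappa> w f =
    (SUP E\<in>parallelepipeds a.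
      ennpowr ((\<integral>\<^sup>+x\<in>E. (ennpowr (emod f x) p * ennreal (w x)) \<partial>lebesgue)
                / ennpowr (wmeasure w E) \<kappa>) (1 / p))"

definition morrey_space ::
  "real^'n \<Rightarrow> real \<Rightarrow> real \<Rightarrow> (real^'n \<Rightarrow> real) \<Rightarrow> (real^'n \<Rightarrow> ereal) set" where
  "morrey_space a p \<kappa> w =
    {f. f \<in> borel_measurable lebesgue \<and>
        (\<forall>K. compact K \<longrightarrow> (\<integral>\<^sup>+x\<in>K. (emod f x * ennreal (w x)) \<partial>lebesgue) < \<infinity>) \<and>
        morrey_norm a p \<kappa> w f < \<infinity>}"

definition maximal :: "real^'n \<Rightarrow> (real^'n \<Rightarrow> ereal) \<Rightarrow> real^'n \<Rightarrow> ereal" where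
  "maximal a f x =
    enn2ereal (SUP t\<in>{0<..}. (\<integral>\<^sup>+y\<in>parallelepiped a x t. emod f y \<partial>lebesgue)
                              / emeasure lebesgue (parallelepiped a x t))"

definition conjugate_exponent :: "real \<Rightarrow> real" where
  "conjugate_exponent p = p / (p - 1)"

lemma conjugate_exponent: "1 / p + 1 / conjugate_exponent p = 1" if "1 < p"
  using that by (simp add: conjugate_exponent_def field_simps)

definition muckenhoupt_A :: "real^'n \<Rightarrow> real \<Rightarrow> (real^'n \<Rightarrow> real) set" where
  "muckenhoupt_A a p =
    {w. weight w \<and>
        (\<exists>C>1. \<forall>E\<in>parallelepipeds a.
          ((\<integral>\<^sup>+x\<in>E. ennreal (w x) \<partial>lebesgue) / emeasure lebesgue E) *
          ennpowr ((\<integral>\<^sup>+x\<in>E. ennreal (w x powr (1 - conjugate_exponent p)) \<partial>lebesgue)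
                    / emeasure lebesgue E) (p - 1)
          \<le> ennreal C)}"

definition muckenhoupt_A1 :: "real^'n \<Rightarrow> (real^'n \<Rightarrow> real) set" where
  "muckenhoupt_A1 a =
    {w. weight w \<and>
        (\<exists>C>1. AE x in lebesgue. maximal a (\<lambda>y. ereal (w y)) x \<le> ereal (C * w x))}"

end

theory Submission
  imports Defs
begin

text \<open>
  Muckenhoupt's condition bounds averages over a parallelepiped \<open>E\<close> by weighted ones:
  \<open>w(E) (\<integral>\<^sub>E g)\<^sup>p \<le> C |E|\<^sup>p \<integral>\<^sub>E g\<^sup>p w\<close>. For indicators \<open>g\<close> of smaller parallelepipeds this says that
  \<open>w\<close> is doubling, so Vitali's covering argument gives the weak type \<open>(1,1)\<close> and Marcinkiewicz
  interpolation the strong type \<open>(q,q)\<close> of the maximal function \<open>M\<^sub>w\<close> with respect to \<open>w\<close>. For \<open>p = 1\<close>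
  the maximal function is dominated by \<open>M\<^sub>w\<close>. For \<open>p > 1\<close> put \<open>\<sigma> = w\<^bsup>1-p'\<^esup>\<close>, which is doubling as well;
  Lerner's inequality \<open>(Mg)\<^bsup>p-1\<^esup> \<le> C M\<^sub>w (M\<^sub>\<sigma> (g/\<sigma>)\<^bsup>p-1\<^esup> / w)\<close> yields the boundedness of \<open>M\<close> on \<open>L\<^sub>p(w)\<close>
  without the reverse Hoelder inequality. On a fixed \<open>E\<close>, averages over parallelepipeds not larger
  than \<open>E\<close> only see \<open>f\<close> on a dilate of \<open>E\<close>, while the larger averages are bounded pointwise by a
  multiple of \<open>\<parallel>f\<parallel> w(E)\<^bsup>(\<kappa>-1)/p\<^esup>\<close>.
\<close>

subsection \<open>Powers of extended nonnegative reals\<close>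

lemma ennpowr_ennreal [simp]: "0 \<le> x \<Longrightarrow> ennpowr (ennreal x) r = ennreal (x powr r)"
  by (simp add: ennpowr_def)

lemma ennpowr_top [simp]: "ennpowr top r = top"
  by (simp add: ennpowr_def)

lemma ennpowr_zero [simp]: "ennpowr 0 r = 0"
  by (simp add: ennpowr_def)

lemma ennpowr_one [simp]: "ennpowr x 1 = x"
  by (cases x) auto

lemma ennpowr_mono:
  assumes "x \<le> y" "0 \<le> r" shows "ennpowr x r \<le> ennpowr y r"
  using assms by (cases x; cases y) (auto intro: powr_mono2 simp: top_unique)

lemma ennpowr_mult:
  assumes "0 < r" shows "ennpowr (x * y) r = ennpowr x r * ennpowr y r"
proof (cases x)
  case (real s)
  show ?thesis
  proof (cases y)
    case (real t)
    with \<open>0 \<le> s\<close> \<open>x = ennreal s\<close> show ?thesis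
      by (simp add: ennreal_mult[symmetric] powr_mult)
  next
    case top
    then show ?thesis
      using \<open>0 \<le> s\<close> \<open>x = ennreal s\<close> by (cases "s = 0") (auto simp: ennreal_mult_top)
  qed
next
  case top
  show ?thesis
  proof (cases y)
    case (real t)
    with top show ?thesis by (cases "t = 0") (auto simp: ennreal_top_mult)
  qed (simp add: top)
qed

lemma ennpowr_ennpowr: "ennpowr (ennpowr x r) s = ennpowr x (r * s)"
  by (cases x) (auto simp: powr_powr)

lemma ennpowr_add: "ennpowr x (r + s) = ennpowr x r * ennpowr x s"
  by (cases x) (auto simp: powr_add ennreal_mult)

lemma measurable_ennpowr [measurable]:
  assumes [measurable]: "f \<in> borel_measurable M"
  shows "(\<lambda>x. ennpowr (f x) r) \<in> borel_measurable M"
  unfolding ennpowr_def by measurable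

text \<open>The tangent of the convex p-th power at \<open>m\<close> lies below its graph; the terms
  are arranged so that nothing is subtracted in \<open>ennreal\<close>. Young's inequality with
  weights \<open>1/p\<close> and \<open>1 - 1/p\<close> yields it.\<close>

lemma ennpowr_tangent:
  assumes "1 < p" "0 < m"
  shows "ennreal (p * m powr (p - 1)) * G \<le> ennpowr G p + ennreal ((p - 1) * m powr p)"
proof (cases G)
  case (real g)
  have "p * m powr (p - 1) * g \<le> g powr p + (p - 1) * m powr p"
  proof (cases "g = 0")
    case False
    with real have "g > 0" by simp
    have *: "p * m powr (p - 1) * g = p * (g powr p) powr (1/p) * (m powr p) powr (1 - 1/p)"
      using \<open>g > 0\<close> assms by (simp add: powr_powr right_diff_distrib)
    have "(g powr p) powr (1/p) * (m powr p) powr (1 - 1/p) \<le> (1/p) * g powr p + (1 - 1/p) * m powr p"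
      using \<open>g > 0\<close> assms by (intro Youngs_inequality_0) auto
    then have "p * ((g powr p) powr (1/p) * (m powr p) powr (1 - 1/p)) \<le> p * ((1/p) * g powr p + (1 - 1/p) * m powr p)"
      using assms by (intro mult_left_mono) auto
    moreover have "p * ((1/p) * g powr p + (1 - 1/p) * m powr p) = g powr p + (p - 1) * m powr p"
      using assms by (simp add: field_simps)
    ultimately show ?thesis
      using * by (metis mult.assoc)
  qed (use assms in auto)
  then show ?thesis
    using real assms by (simp add: ennreal_mult[symmetric] ennreal_plus[symmetric] del: ennreal_plus)
qed simp

subsection \<open>Anisotropic parallelepipeds\<close>

text \<open>A countable cover by Borel sets of finite \<open>lborel\<close> measure serves
  \<open>lebesgue\<close> as well. Tonelli's theorem in the interpolation argument requires
  this.\<close>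

lemma sigma_finite_lebesgue: "sigma_finite_measure (lebesgue :: 'a::euclidean_space measure)"
proof
  obtain A :: "'a set set" where "countable A" "A \<subseteq> sets lborel" "\<Union>A = space lborel"
      "\<forall>a\<in>A. emeasure lborel a \<noteq> \<infinity>"
    using lborel.sigma_finite_countable by blast
  then show "\<exists>A::'a set set. countable A \<and> A \<subseteq> sets lebesgue \<and> \<Union>A = space lebesgue \<and>
      (\<forall>a\<in>A. emeasure lebesgue a \<noteq> \<infinity>)"
    by (intro exI[of _ A]) auto
qed

locale anisotropy =
  fixes a :: "real^'n"
  assumes a_pos: "\<And>i. 0 < a $ i"
begin

abbreviation pbox :: "real^'n \<Rightarrow> real \<Rightarrow> (real^'n) set" where
  "pbox \<equiv> parallelepiped a"

abbreviation vol :: "real^'n \<Rightarrow> real \<Rightarrow> ennreal" where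
  "vol x t \<equiv> emeasure lebesgue (pbox x t)"

text \<open>A factor that enlarges every side of a box at least threefold. The sum dominates each
  \<open>3 powr (1 / a $ i)\<close> and avoids a maximum over the index type.\<close>

definition dil :: real where
  "dil = (\<Sum>i\<in>UNIV. 3 powr (1 / a $ i))"

definition hom_dim :: real where
  "hom_dim = (\<Sum>i\<in>UNIV. a $ i)"

lemma dil_pos: "0 < dil"
  unfolding dil_def by (intro sum_pos) auto

lemma dil_powr_ge: "3 \<le> dil powr (a $ i)"
proof -
  have "3 = (3 powr (1 / a $ i)) powr (a $ i)"
    using a_pos[of i] by (simp add: powr_powr)
  also have "\<dots> \<le> dil powr (a $ i)"
    unfolding dil_def using a_pos[of i] by (intro powr_mono2 member_le_sum) auto
  finally show ?thesis .
qed

lemma dil_gt_1: "1 < dil"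
proof (rule ccontr)
  assume "\<not> 1 < dil"
  \<comment> \<open>Any single coordinate yields the contradiction; \<open>undefined\<close> merely
    names one.\<close>
  then have "dil powr (a $ undefined) \<le> 1 powr (a $ undefined)"
    using dil_pos a_pos by (intro powr_mono2) (auto simp: less_imp_le)
  with dil_powr_ge[of undefined] show False by simp
qed

lemma dil_powr: "0 < t \<Longrightarrow> 3 * t powr (a $ i) \<le> (dil * t) powr (a $ i)"
  using dil_powr_ge[of i] dil_pos by (simp add: powr_mult)

lemma pbox_eq_cbox: "pbox x t = cbox (x - (\<chi> i. t powr (a $ i))) (x + (\<chi> i. t powr (a $ i)))"
  by (auto simp: parallelepiped_def mem_box_cart abs_le_iff algebra_simps)

lemma compact_pbox: "compact (pbox x t)"
  by (simp add: pbox_eq_cbox)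

lemma sets_pbox [measurable, simp]: "pbox x t \<in> sets lebesgue"
  by (simp add: pbox_eq_cbox)

lemma interior_pbox:
  "interior (pbox x t) = box (x - (\<chi> i. t powr (a $ i))) (x + (\<chi> i. t powr (a $ i)))"
  by (simp add: pbox_eq_cbox interior_cbox)

lemma mem_interior_pbox: "y \<in> interior (pbox x t) \<longleftrightarrow> (\<forall>i. \<bar>y $ i - x $ i\<bar> < t powr (a $ i))"
  by (auto simp: interior_pbox mem_box_cart abs_less_iff algebra_simps)

lemma center_mem_interior_pbox: "0 < t \<Longrightarrow> x \<in> interior (pbox x t)"
  by (simp add: mem_interior_pbox)

lemma center_mem_pbox: "0 < t \<Longrightarrow> x \<in> pbox x t"
  by (simp add: parallelepiped_def)

lemma pbox_mono:
  assumes "0 < s" "s \<le> t" shows "pbox x s \<subseteq> pbox x t"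
proof -
  have "s powr (a $ i) \<le> t powr (a $ i)" for i
    using assms a_pos[of i] by (intro powr_mono2) auto
  then show ?thesis
    by (fastforce simp: parallelepiped_def intro: order_trans)
qed

lemma vol_eq:
  assumes "0 < t" shows "vol x t = ennreal (2 ^ CARD('n) * t powr hom_dim)"
proof -
  let ?r = "\<chi> i. t powr (a $ i)"
  have ne: "cbox (x - ?r) (x + ?r) \<noteq> {}"
    using center_mem_pbox[OF assms, of x] by (auto simp: pbox_eq_cbox)
  have "vol x t = ennreal (measure lborel (cbox (x - ?r) (x + ?r)))"
    unfolding pbox_eq_cbox using emeasure_lborel_cbox_finite[of "x - ?r" "x + ?r"]
    by (subst emeasure_eq_ennreal_measure[symmetric]) auto
  also have "measure lborel (cbox (x - ?r) (x + ?r)) = (\<Prod>i\<in>UNIV. 2 * t powr (a $ i))"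
    using content_cbox_cart[OF ne] by simp
  also have "\<dots> = 2 ^ CARD('n) * t powr hom_dim"
    using assms by (simp add: prod.distrib hom_dim_def powr_sum)
  finally show ?thesis .
qed

lemma vol_pos: "0 < t \<Longrightarrow> 0 < vol x t"
  by (simp add: vol_eq del: emeasure_completion)

lemma vol_finite: "0 < t \<Longrightarrow> vol x t < \<infinity>"
  by (simp add: vol_eq del: emeasure_completion)

lemma vol_dil: "0 < t \<Longrightarrow> vol x (dil * t) = ennreal (dil powr hom_dim) * vol x t"
  using dil_pos by (simp add: vol_eq powr_mult ennreal_mult[symmetric] mult_ac del: emeasure_completion)

lemma emeasure_interior_pbox: "emeasure lebesgue (interior (pbox x t)) = vol x t"
  unfolding interior_pbox unfolding pbox_eq_cbox
  by (simp add: emeasure_lborel_box_eq emeasure_lborel_cbox_eq)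

section \<open>Engulfing and Vitali's covering lemma for anisotropic boxes\<close>

lemma pbox_engulf:
  assumes "0 < s" "s \<le> t" "pbox x t \<inter> pbox y s \<noteq> {}"
  shows "pbox y s \<subseteq> pbox x (dil * t)"
proof
  fix z assume z: "z \<in> pbox y s"
  obtain v where v: "v \<in> pbox x t" "v \<in> pbox y s"
    using assms by blast
  show "z \<in> pbox x (dil * t)"
    unfolding parallelepiped_def
  proof (intro CollectI allI)
    fix i
    \<comment> \<open>The triangle inequality along \<open>x\<close>, \<open>v\<close>,
      \<open>y\<close>, \<open>z\<close> costs at most three half-sides of the larger box, which is
      what \<open>dil\<close> provides.\<close>
    have "\<bar>v $ i - x $ i\<bar> \<le> t powr (a $ i)" "\<bar>v $ i - y $ i\<bar> \<le> s powr (a $ i)"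
        "\<bar>z $ i - y $ i\<bar> \<le> s powr (a $ i)"
      using v z by (auto simp: parallelepiped_def)
    moreover have "s powr (a $ i) \<le> t powr (a $ i)"
      using assms a_pos[of i] by (intro powr_mono2) auto
    moreover have "3 * t powr (a $ i) \<le> (dil * t) powr (a $ i)"
      using assms by (intro dil_powr) auto
    ultimately show "\<bar>z $ i - x $ i\<bar> \<le> (dil * t) powr (a $ i)"
      by linarith
  qed
qed

text \<open>Greedy selection: keep a box of largest parameter, discard every box that meets it,
  since its dilate engulfs them, and continue with the boxes that remain.\<close>

lemma vitali_finite:
  assumes "finite I" "\<And>x t. (x, t) \<in> I \<Longrightarrow> 0 < t"
  obtains J where "J \<subseteq> I" "disjoint_family_on (\<lambda>(x, t). pbox x t) J"
    "(\<Union>(x, t)\<in>I. pbox x t) \<subseteq> (\<Union>(x, t)\<in>J. pbox x (dil * t))"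
proof -
  have "\<exists>J\<subseteq>I. disjoint_family_on (\<lambda>(x, t). pbox x t) J \<and>
      (\<Union>(x, t)\<in>I. pbox x t) \<subseteq> (\<Union>(x, t)\<in>J. pbox x (dil * t))"
    using assms
  proof (induction I rule: finite_psubset_induct)
    case (psubset I)
    show ?case
    proof (cases "I = {}")
      case False
      obtain j where j: "j \<in> I" "\<And>i. i \<in> I \<Longrightarrow> snd i \<le> snd j"
        using False psubset.hyps Max_in[of "snd ` I"] Max_ge[of "snd ` I"] by fastforce
      obtain x t where xt: "j = (x, t)" by (cases j)
      define I' where "I' = {(y, s) \<in> I. pbox x t \<inter> pbox y s = {}}"
      have "0 < t" using psubset.prems j xt by auto
      \<comment> \<open>The chosen box meets itself, so the remaining family is strictly smaller and
        the induction applies.\<close>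
      then have "x \<in> pbox x t" by (rule center_mem_pbox)
      then have "j \<notin> I'" by (auto simp: I'_def xt)
      then have "I' \<subset> I" using j(1) by (auto simp: I'_def)
      then obtain J where J: "J \<subseteq> I'" "disjoint_family_on (\<lambda>(x, t). pbox x t) J"
          "(\<Union>(x, t)\<in>I'. pbox x t) \<subseteq> (\<Union>(x, t)\<in>J. pbox x (dil * t))"
        using psubset.IH[of I'] psubset.prems by blast
      have "disjoint_family_on (\<lambda>(x, t). pbox x t) (insert j J)"
        using J(1,2) xt by (auto simp: disjoint_family_on_def I'_def)
      moreover have cover: "pbox y s \<subseteq> (\<Union>(x, t)\<in>insert j J. pbox x (dil * t))" if "(y, s) \<in> I" for y s
      proof (cases "(y, s) \<in> I'")
        case True
        then show ?thesis using J(3) by fastforce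
      next
        case False
        then have "pbox x t \<inter> pbox y s \<noteq> {}" using that by (auto simp: I'_def)
        then have "pbox y s \<subseteq> pbox x (dil * t)"
          using that j(2)[OF that] xt psubset.prems[OF that] by (intro pbox_engulf) auto
        then show ?thesis by (auto simp: xt)
      qed
      moreover have "(\<Union>(x, t)\<in>I. pbox x t) \<subseteq> (\<Union>(x, t)\<in>insert j J. pbox x (dil * t))"
      proof (rule UN_least)
        fix i assume "i \<in> I"
        then show "(case i of (x, t) \<Rightarrow> pbox x t) \<subseteq> (\<Union>(x, t)\<in>insert j J. pbox x (dil * t))"
          by (cases i) (simp only: prod.case cover)
      qed
      moreover have "insert j J \<subseteq> I"
        using J(1) \<open>I' \<subset> I\<close> j(1) by blast
      ultimately show ?thesis by (intro exI conjI)
    qed (auto simp: disjoint_family_on_def)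
  qed
  then show ?thesis using that by blast
qed

end

subsection \<open>Weighted maximal functions\<close>

lemma wmeasure_eq_emeasure_density:
  assumes "u \<in> borel_measurable lebesgue" "S \<in> sets lebesgue"
  shows "emeasure (density lebesgue (\<lambda>x. ennreal (u x))) S = wmeasure u S"
  unfolding wmeasure_def using assms by (subst emeasure_density) auto

lemma wmeasure_mono: "S \<subseteq> T \<Longrightarrow> wmeasure u S \<le> wmeasure u T"
  unfolding wmeasure_def by (intro nn_integral_mono) (auto simp: indicator_def)

lemma ennreal_less_divide_iff:
  fixes I m l :: ennreal
  assumes "0 < m" "m < top" shows "l < I / m \<longleftrightarrow> l * m < I"
proof (cases m)
  case (real r)
  then have "0 < r" using assms by simp
  then show ?thesis
    using real by (cases I; cases l)
      (auto simp: divide_ennreal ennreal_less_iff ennreal_mult[symmetric] ennreal_top_divide ennreal_top_mult pos_less_divide_eq)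
qed (use assms in simp)

context anisotropy begin

text \<open>Requiring \<open>x\<close> to be an interior point makes the level sets open, hence measurable.\<close>

definition wmax :: "(real^'n \<Rightarrow> real) \<Rightarrow> (real^'n \<Rightarrow> ennreal) \<Rightarrow> real^'n \<Rightarrow> ennreal" where
  "wmax u g x = (SUP (y, t)\<in>{(y, t). 0 < t \<and> x \<in> interior (pbox y t)}.
     (\<integral>\<^sup>+z\<in>pbox y t. (g z * ennreal (u z)) \<partial>lebesgue) / wmeasure u (pbox y t))"

lemma wmax_ge:
  assumes "0 < t" "x \<in> interior (pbox y t)"
  shows "(\<integral>\<^sup>+z\<in>pbox y t. (g z * ennreal (u z)) \<partial>lebesgue) / wmeasure u (pbox y t) \<le> wmax u g x"
  unfolding wmax_def using assms by (intro SUP_upper2[of "(y, t)"]) auto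

lemma wmax_level_set:
  "{x. l < wmax u g x} = \<Union>{interior (pbox y t) |y t. 0 < t \<and>
     l < (\<integral>\<^sup>+z\<in>pbox y t. (g z * ennreal (u z)) \<partial>lebesgue) / wmeasure u (pbox y t)}"
  unfolding wmax_def less_SUP_iff by fastforce

lemma open_wmax_level_set: "open {x. l < wmax u g x}"
  unfolding wmax_level_set by (intro open_Union) auto

lemma measurable_wmax [measurable]: "wmax u g \<in> borel_measurable lebesgue"
  by (rule borel_measurableI_greater) (use open_wmax_level_set in auto)

end

section \<open>Weak type (1,1) of the weighted maximal function for doubling weights\<close>

locale doubling_weight = anisotropy a for a :: "real^'n" +
  fixes u :: "real^'n \<Rightarrow> real" and D :: real
  assumes measurable_weight [measurable]: "u \<in> borel_measurable lebesgue"
    and wmeasure_pbox_finite: "0 < t \<Longrightarrow> wmeasure u (pbox x t) < \<infinity>"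
    and doubling: "0 < t \<Longrightarrow> wmeasure u (pbox x (dil * t)) \<le> ennreal D * wmeasure u (pbox x t)"
    and doubling_const_ge_1: "1 \<le> D"
begin

text \<open>The dilates of a disjoint subfamily cover the union, doubling pays \<open>D\<close> for
  passing from the dilates to the boxes, and by disjointness the integrals of \<open>g\<close> over
  the boxes add up to at most the full integral.\<close>

lemma wmax_weak_finite:
  assumes [measurable]: "g \<in> borel_measurable lebesgue"
    and "finite I" and I: "\<And>x t. (x, t) \<in> I \<Longrightarrow> 0 < t \<and>
      l * wmeasure u (pbox x t) \<le> (\<integral>\<^sup>+z\<in>pbox x t. (g z * ennreal (u z)) \<partial>lebesgue)"
  shows "l * wmeasure u (\<Union>(x, t)\<in>I. pbox x t) \<le> ennreal D * (\<integral>\<^sup>+z. g z * ennreal (u z) \<partial>lebesgue)"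
proof -
  define \<mu> where "\<mu> = density lebesgue (\<lambda>x. ennreal (u x))"
  \<comment> \<open>The integral of \<open>g\<close> against \<open>u\<close> is made a measure, so
    that disjointness can be used as finite additivity.\<close>
  define \<nu> where "\<nu> = density lebesgue (\<lambda>x. g x * ennreal (u x))"
  have [simp]: "sets \<mu> = sets lebesgue" "sets \<nu> = sets lebesgue" "space \<nu> = UNIV"
    by (simp_all add: \<mu>_def \<nu>_def)
  have \<mu>: "emeasure \<mu> S = wmeasure u S" if "S \<in> sets lebesgue" for S
    using that by (simp add: \<mu>_def wmeasure_eq_emeasure_density)
  have \<nu>: "emeasure \<nu> S = (\<integral>\<^sup>+z\<in>S. (g z * ennreal (u z)) \<partial>lebesgue)" if "S \<in> sets lebesgue" for S
    using that by (simp add: \<nu>_def emeasure_density)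
  obtain J where J: "J \<subseteq> I" "disjoint_family_on (\<lambda>(x, t). pbox x t) J"
      "(\<Union>(x, t)\<in>I. pbox x t) \<subseteq> (\<Union>(x, t)\<in>J. pbox x (dil * t))"
    using vitali_finite[of I] \<open>finite I\<close> I by blast
  have "finite J" using J(1) \<open>finite I\<close> by (rule finite_subset)
  have "l * wmeasure u (\<Union>(x, t)\<in>I. pbox x t) \<le> l * emeasure \<mu> (\<Union>(x, t)\<in>J. pbox x (dil * t))"
    using J(3) \<open>finite J\<close> by (subst \<mu>) (auto intro!: mult_left_mono wmeasure_mono)
  also have "\<dots> \<le> l * (\<Sum>i\<in>J. emeasure \<mu> (case i of (x, t) \<Rightarrow> pbox x (dil * t)))"
    using \<open>finite J\<close> by (intro mult_left_mono emeasure_subadditive_finite) auto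
  also have "\<dots> = (\<Sum>i\<in>J. l * emeasure \<mu> (case i of (x, t) \<Rightarrow> pbox x (dil * t)))"
    by (simp add: sum_distrib_left)
  also have "\<dots> \<le> (\<Sum>i\<in>J. ennreal D * emeasure \<nu> (case i of (x, t) \<Rightarrow> pbox x t))"
  proof (rule sum_mono)
    fix i assume "i \<in> J"
    then obtain x t where i: "i = (x, t)" "(x, t) \<in> I" using J(1) by (cases i) auto
    have "l * wmeasure u (pbox x (dil * t)) \<le> l * (ennreal D * wmeasure u (pbox x t))"
      using doubling I[OF i(2)] by (intro mult_left_mono) auto
    also have "\<dots> = ennreal D * (l * wmeasure u (pbox x t))"
      by (simp add: mult_ac)
    also have "\<dots> \<le> ennreal D * (\<integral>\<^sup>+z\<in>pbox x t. (g z * ennreal (u z)) \<partial>lebesgue)"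
      using I[OF i(2)] by (intro mult_left_mono) auto
    finally show "l * emeasure \<mu> (case i of (x, t) \<Rightarrow> pbox x (dil * t))
        \<le> ennreal D * emeasure \<nu> (case i of (x, t) \<Rightarrow> pbox x t)"
      by (simp add: i \<mu> \<nu>)
  qed
  also have "\<dots> = ennreal D * emeasure \<nu> (\<Union>i\<in>J. case i of (x, t) \<Rightarrow> pbox x t)"
    using \<open>finite J\<close> J(2) by (subst sum_emeasure[symmetric]) (auto simp: sum_distrib_left)
  also have "\<dots> \<le> ennreal D * emeasure \<nu> (space \<nu>)"
    by (intro mult_left_mono emeasure_space) auto
  also have "\<dots> = ennreal D * (\<integral>\<^sup>+z. g z * ennreal (u z) \<partial>lebesgue)"
    using \<nu>[of UNIV] by simp
  finally show ?thesis .
qed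

text \<open>The level set is a union of open boxes with large averages. Lindelof's theorem makes the
  union countable, the bound for finite families applies to the partial unions, and continuity from
  below passes to the limit.\<close>

proposition wmax_weak:
  assumes [measurable]: "g \<in> borel_measurable lebesgue"
  shows "l * wmeasure u {x. l < wmax u g x} \<le> ennreal D * (\<integral>\<^sup>+z. g z * ennreal (u z) \<partial>lebesgue)"
proof -
  define F where "F = {interior (pbox y t) |y t. 0 < t \<and>
     l < (\<integral>\<^sup>+z\<in>pbox y t. (g z * ennreal (u z)) \<partial>lebesgue) / wmeasure u (pbox y t)}"
  define \<mu> where "\<mu> = density lebesgue (\<lambda>x. ennreal (u x))"
  have [simp]: "sets \<mu> = sets lebesgue"
    by (simp add: \<mu>_def)
  have \<mu>: "emeasure \<mu> S = wmeasure u S" if "S \<in> sets lebesgue" for S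
    using that by (simp add: \<mu>_def wmeasure_eq_emeasure_density)
  have S: "{x. l < wmax u g x} = \<Union>F"
    unfolding F_def by (rule wmax_level_set)
  obtain F' where F': "F' \<subseteq> F" "countable F'" "\<Union>F' = \<Union>F"
    by (rule Lindelof[of F]) (auto simp: F_def)
  show ?thesis
  proof (cases "F' = {}")
    case True
    then have "{x. l < wmax u g x} = {}" using S F'(3) by blast
    then show ?thesis by (simp add: wmeasure_def)
  next
    case False
    define B where "B n = (\<Union>k\<le>n. from_nat_into F' k)" for n :: nat
    have "open (from_nat_into F' k)" for k
      using from_nat_into[OF False, of k] F' by (auto simp: F_def)
    then have [measurable, simp]: "B n \<in> sets lebesgue" for n
      unfolding B_def by (intro sets.finite_UN) auto
    have "(\<Union>n. B n) = \<Union>F'"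
      using from_nat_into_surj[OF F'(2)] from_nat_into[OF False] unfolding B_def by fastforce
    moreover have "\<Union>F \<in> sets lebesgue"
      unfolding S[symmetric] using open_wmax_level_set by auto
    moreover have "incseq B"
      unfolding B_def by (intro monoI UN_mono) auto
    ultimately have "(SUP n. emeasure \<mu> (B n)) = emeasure \<mu> (\<Union>F)" and "\<Union>F \<in> sets lebesgue"
      using SUP_emeasure_incseq[of B \<mu>] F'(3) by (auto simp only: image_subset_iff \<open>sets \<mu> = sets lebesgue\<close> \<open>\<And>n. B n \<in> sets lebesgue\<close>)
    then have "wmeasure u (\<Union>F) = (SUP n. wmeasure u (B n))"
      by (simp only: \<mu> \<open>\<And>n. B n \<in> sets lebesgue\<close>)
    moreover have "l * wmeasure u (B n) \<le> ennreal D * (\<integral>\<^sup>+z. g z * ennreal (u z) \<partial>lebesgue)" for n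
    proof -
      define T where "T = {(y, t). 0 < t \<and>
         l < (\<integral>\<^sup>+z\<in>pbox y t. (g z * ennreal (u z)) \<partial>lebesgue) / wmeasure u (pbox y t)}"
      have "F = (\<lambda>(y, t). interior (pbox y t)) ` T"
        unfolding F_def T_def by auto
      then have "from_nat_into F' ` {..n} \<subseteq> (\<lambda>(y, t). interior (pbox y t)) ` T"
        using from_nat_into[OF False] F'(1) by blast
      \<comment> \<open>The covering lemma works with pairs of centre and parameter, so finitely
        many pairs representing these interiors are chosen.\<close>
      from finite_subset_image[OF _ this] obtain I where I: "I \<subseteq> T" "finite I" "from_nat_into F' ` {..n} = (\<lambda>(y, t). interior (pbox y t)) ` I"
        by auto
      have "B n = (\<Union>(y, t)\<in>I. interior (pbox y t))"
        unfolding B_def I(3) ..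
      also have "\<dots> \<subseteq> (\<Union>(y, t)\<in>I. pbox y t)"
        by (intro UN_mono) (auto simp: interior_subset[THEN subsetD])
      finally have "l * wmeasure u (B n) \<le> l * wmeasure u (\<Union>(y, t)\<in>I. pbox y t)"
        by (intro mult_left_mono wmeasure_mono) auto
      also have "\<dots> \<le> ennreal D * (\<integral>\<^sup>+z. g z * ennreal (u z) \<partial>lebesgue)"
      proof (rule wmax_weak_finite)
        fix x t assume "(x, t) \<in> I"
        then have "0 < t" and "l < (\<integral>\<^sup>+z\<in>pbox x t. (g z * ennreal (u z)) \<partial>lebesgue) / wmeasure u (pbox x t)"
          using I(1) by (auto simp: T_def)
        \<comment> \<open>A box of weight zero is treated apart: the quotient cannot be multiplied
          out there, but the left-hand side of the bound vanishes.\<close>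
        then show "0 < t \<and> l * wmeasure u (pbox x t) \<le> (\<integral>\<^sup>+z\<in>pbox x t. (g z * ennreal (u z)) \<partial>lebesgue)"
          using wmeasure_pbox_finite[of t x] ennreal_less_divide_iff[of "wmeasure u (pbox x t)" l]
          by (cases "wmeasure u (pbox x t) = 0") (auto simp: zero_less_iff_neq_zero)
      qed (use I in auto)
      finally show ?thesis .
    qed
    ultimately show ?thesis
      unfolding S by (auto simp: SUP_mult_left_ennreal intro!: SUP_least)
  qed
qed

end

text \<open>The layer cake formula for a single value \<open>h\<close>, infinity included;
  integrated over space it expresses integrals of powers through level sets.\<close>

lemma nn_integral_powr_lessThan:
  fixes s :: real
  assumes "0 < s"
  shows "(\<integral>\<^sup>+l. ennreal (s * l powr (s - 1)) * indicator {l. 0 < l \<and> ennreal l < h} l \<partial>lborel) = ennpowr h s"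
proof -
  have fin: "(\<integral>\<^sup>+l. ennreal (s * l powr (s - 1)) * indicator {0..c} l \<partial>lborel) = ennreal (c powr s)"
    if "0 \<le> c" for c
  proof -
    have "((\<lambda>l. s * l powr (s - 1)) has_integral s * (c powr (s - 1 + 1) / (s - 1 + 1))) {0..c}"
      using has_integral_powr_from_0[of "s - 1" c] assms that by (intro has_integral_mult_right) auto
    then have "((\<lambda>l. s * l powr (s - 1)) has_integral c powr s) {0..c}"
      using assms by simp
    from nn_integral_has_integral_lebesgue[OF _ this]
    have "(\<integral>\<^sup>+l. ennreal (indicator {0..c} l * (s * l powr (s - 1))) \<partial>lborel) = ennreal (c powr s)"
      using assms by auto
    moreover have "ennreal (indicator {0..c} l * (s * l powr (s - 1))) = ennreal (s * l powr (s - 1)) * indicator {0..c} l"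
      for l by (simp add: indicator_def)
    ultimately show ?thesis by simp
  qed
  show ?thesis
  proof (cases h)
    case (real c)
    \<comment> \<open>The interval of levels is open while the computed integral is over a closed
      one; only the two endpoints differ.\<close>
    have "AE l in lborel. l \<noteq> 0 \<and> l \<noteq> c"
      using AE_lborel_singleton[of 0] AE_lborel_singleton[of c] by eventually_elim auto
    then have "AE l in lborel. ennreal (s * l powr (s - 1)) * indicator {l. 0 < l \<and> ennreal l < h} l =
        ennreal (s * l powr (s - 1)) * indicator {0..c} l"
      by eventually_elim (auto simp: indicator_def real ennreal_less_iff)
    then have "(\<integral>\<^sup>+l. ennreal (s * l powr (s - 1)) * indicator {l. 0 < l \<and> ennreal l < h} l \<partial>lborel) =
        (\<integral>\<^sup>+l. ennreal (s * l powr (s - 1)) * indicator {0..c} l \<partial>lborel)"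
      by (rule nn_integral_cong_AE)
    then show ?thesis using fin[of c] real by simp
  next
    case top
    let ?I = "\<integral>\<^sup>+l. ennreal (s * l powr (s - 1)) * indicator {l. 0 < l \<and> ennreal l < h} l \<partial>lborel"
    have le: "of_nat n \<le> ?I" for n
    proof -
      \<comment> \<open>The upper limit is chosen so that the integral up to it equals
        \<open>n\<close>. Hence the full integral is at least every natural number.\<close>
      have "ennreal (of_nat n) = ennreal ((of_nat n powr (1 / s)) powr s)"
        using assms by (simp add: powr_powr)
      also have "\<dots> = (\<integral>\<^sup>+l. ennreal (s * l powr (s - 1)) * indicator {0..of_nat n powr (1 / s)} l \<partial>lborel)"
        by (subst fin) auto
      also have "\<dots> \<le> ?I"
      proof (rule nn_integral_mono_AE)
        show "AE l in lborel. ennreal (s * l powr (s - 1)) * indicator {0..of_nat n powr (1 / s)} l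
          \<le> ennreal (s * l powr (s - 1)) * indicator {l. 0 < l \<and> ennreal l < h} l"
          using AE_lborel_singleton[of 0] by eventually_elim (auto simp: indicator_def top)
      qed
      finally show ?thesis by (simp add: ennreal_of_nat_eq_real_of_nat)
    qed
    have "?I = top"
    proof (rule ccontr)
      assume "?I \<noteq> top"
      then obtain n where "?I < of_nat n"
        using ennreal_Ex_less_of_nat[of ?I] by (auto simp: less_top)
      with le[of n] show False by simp
    qed
    then show ?thesis using top by simp
  qed
qed

section \<open>Marcinkiewicz interpolation between the weak type (1,1) and the trivial bound at
  infinity\<close>

context doubling_weight begin

text \<open>The part of \<open>g\<close> not exceeding \<open>l\<close> has averages at most
  \<open>l\<close>. This is the trivial endpoint of the interpolation.\<close>

lemma wmax_truncate:
  assumes [measurable]: "g \<in> borel_measurable lebesgue"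
  shows "wmax u g x \<le> wmax u (\<lambda>z. g z * indicator {z. l < g z} z) x + l"
  unfolding wmax_def[of u g]
proof (rule SUP_least, clarify)
  fix y t assume t: "0 < t" "x \<in> interior (pbox y t)"
  let ?g = "\<lambda>z. g z * indicator {z. l < g z} z"
  let ?m = "wmeasure u (pbox y t)"
  have "(\<integral>\<^sup>+z\<in>pbox y t. (g z * ennreal (u z)) \<partial>lebesgue)
      \<le> (\<integral>\<^sup>+z. ?g z * ennreal (u z) * indicator (pbox y t) z + l * (ennreal (u z) * indicator (pbox y t) z) \<partial>lebesgue)"
    by (intro nn_integral_mono) (auto simp: indicator_def intro: mult_right_mono)
  also have "\<dots> = (\<integral>\<^sup>+z\<in>pbox y t. (?g z * ennreal (u z)) \<partial>lebesgue) + l * ?m"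
    unfolding wmeasure_def by (subst nn_integral_add) (auto simp: nn_integral_cmult)
  finally have "(\<integral>\<^sup>+z\<in>pbox y t. (g z * ennreal (u z)) \<partial>lebesgue) / ?m \<le>
      ((\<integral>\<^sup>+z\<in>pbox y t. (?g z * ennreal (u z)) \<partial>lebesgue) + l * ?m) / ?m"
    by (rule divide_right_mono_ennreal)
  also have "\<dots> = (\<integral>\<^sup>+z\<in>pbox y t. (?g z * ennreal (u z)) \<partial>lebesgue) / ?m + l * (?m / ?m)"
    by (simp add: add_divide_distrib_ennreal ennreal_times_divide)
  also have "\<dots> \<le> wmax u ?g x + l * 1"
  proof (intro add_mono mult_left_mono wmax_ge t)
    \<comment> \<open>Only an inequality, since a box of weight zero gives
      \<open>0 / 0 = 0\<close>.\<close>
    show "?m / ?m \<le> 1"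
      using wmeasure_pbox_finite[OF t(1), of y] by (cases "?m = 0") (auto simp: ennreal_divide_self)
  qed auto
  finally show "(\<integral>\<^sup>+z\<in>pbox y t. (g z * ennreal (u z)) \<partial>lebesgue) / ?m \<le> wmax u ?g x + l"
    by simp
qed

text \<open>At height \<open>l\<close> the weak type bound is applied to the values of
  \<open>g\<close> above \<open>l / 2\<close> only; the layer cake formula and Tonelli's theorem
  then integrate over \<open>l\<close>. The constant is \<open>2 * D * q\<close> times
  \<open>2 powr (q - 1) / (q - 1)\<close>.\<close>

proposition wmax_strong:
  assumes [measurable]: "g \<in> borel_measurable lebesgue" and q: "1 < q"
  shows "(\<integral>\<^sup>+x. ennpowr (wmax u g x) q * ennreal (u x) \<partial>lebesgue)
    \<le> ennreal (D * 2 powr q * q / (q - 1)) * (\<integral>\<^sup>+x. ennpowr (g x) q * ennreal (u x) \<partial>lebesgue)"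
proof -
  interpret L: sigma_finite_measure "lebesgue :: (real^'n) measure"
    by (rule sigma_finite_lebesgue)
  interpret P: pair_sigma_finite "lebesgue :: (real^'n) measure" "lborel :: real measure" ..
  let ?W = "wmax u g"
  have [measurable]: "wmax u g \<in> borel_measurable lebesgue" by (rule measurable_wmax)
  have weak: "wmeasure u {x. ennreal l < ?W x} \<le>
      ennreal (2 * D / l) * (\<integral>\<^sup>+z. g z * ennreal (u z) * indicator {z. ennreal (l / 2) < g z} z \<partial>lebesgue)"
    (is "_ \<le> _ * ?I") if "0 < l" for l
  proof -
    let ?g = "\<lambda>z. g z * indicator {z. ennreal (l / 2) < g z} z"
    have "ennreal (l / 2) < wmax u ?g x" if "ennreal l < ?W x" for x
    proof (rule ccontr)
      assume "\<not> ?thesis"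
      then have "?W x \<le> ennreal (l / 2) + ennreal (l / 2)"
        using wmax_truncate[of g x "ennreal (l / 2)"] by (meson add_right_mono assms(1) linorder_not_less order_trans)
      also have "\<dots> = ennreal l"
        using \<open>0 < l\<close> by (simp flip: ennreal_plus)
      finally show False using that by simp
    qed
    then have "ennreal (l / 2) * wmeasure u {x. ennreal l < ?W x} \<le> ennreal (l / 2) * wmeasure u {x. ennreal (l / 2) < wmax u ?g x}"
      by (intro mult_left_mono wmeasure_mono) auto
    also have "\<dots> \<le> ennreal D * (\<integral>\<^sup>+z. ?g z * ennreal (u z) \<partial>lebesgue)"
      by (rule wmax_weak) measurable
    also have "(\<integral>\<^sup>+z. ?g z * ennreal (u z) \<partial>lebesgue) = ?I"
      by (simp add: mult_ac)
    finally have "ennreal (2 / l) * (ennreal (l / 2) * wmeasure u {x. ennreal l < ?W x}) \<le> ennreal (2 / l) * (ennreal D * ?I)"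
      by (rule mult_left_mono) auto
    then show ?thesis
      using \<open>0 < l\<close> doubling_const_ge_1 by (simp add: mult.assoc[symmetric] ennreal_mult[symmetric])
  qed
  have "(\<integral>\<^sup>+x. ennpowr (?W x) q * ennreal (u x) \<partial>lebesgue) =
      (\<integral>\<^sup>+x. \<integral>\<^sup>+l. ennreal (q * l powr (q - 1)) * indicator {l. 0 < l \<and> ennreal l < ?W x} l * ennreal (u x) \<partial>lborel \<partial>lebesgue)"
    using q by (subst nn_integral_multc) (auto simp: nn_integral_powr_lessThan)
  also have "\<dots> = (\<integral>\<^sup>+l. \<integral>\<^sup>+x. ennreal (q * l powr (q - 1)) * indicator {l. 0 < l \<and> ennreal l < ?W x} l * ennreal (u x) \<partial>lebesgue \<partial>lborel)"
    by (rule P.Fubini'[symmetric]) measurable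
  also have "\<dots> \<le> (\<integral>\<^sup>+l. \<integral>\<^sup>+x. ennreal (2 * D * q) * (ennreal (l powr (q - 2)) * indicator {l. 0 < l \<and> ennreal (l / 2) < g x} l * (g x * ennreal (u x))) \<partial>lebesgue \<partial>lborel)"
  proof (rule nn_integral_mono)
    fix l :: real
    show "(\<integral>\<^sup>+x. ennreal (q * l powr (q - 1)) * indicator {l. 0 < l \<and> ennreal l < ?W x} l * ennreal (u x) \<partial>lebesgue)
      \<le> (\<integral>\<^sup>+x. ennreal (2 * D * q) * (ennreal (l powr (q - 2)) * indicator {l. 0 < l \<and> ennreal (l / 2) < g x} l * (g x * ennreal (u x))) \<partial>lebesgue)"
    proof (cases "0 < l")
      case True
      have "(\<integral>\<^sup>+x. ennreal (q * l powr (q - 1)) * indicator {l. 0 < l \<and> ennreal l < ?W x} l * ennreal (u x) \<partial>lebesgue)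
        = (\<integral>\<^sup>+x. ennreal (q * l powr (q - 1)) * (ennreal (u x) * indicator {x. ennreal l < ?W x} x) \<partial>lebesgue)"
        using True by (intro nn_integral_cong) (auto simp: indicator_def)
      also have "\<dots> = ennreal (q * l powr (q - 1)) * wmeasure u {x. ennreal l < ?W x}"
        unfolding wmeasure_def by (subst nn_integral_cmult) auto
      also have "\<dots> \<le> ennreal (q * l powr (q - 1)) * (ennreal (2 * D / l) *
          (\<integral>\<^sup>+z. g z * ennreal (u z) * indicator {z. ennreal (l / 2) < g z} z \<partial>lebesgue))"
        using weak[OF True] by (rule mult_left_mono) auto
      also have "\<dots> = ennreal (q * l powr (q - 1) * (2 * D / l)) *
          (\<integral>\<^sup>+z. g z * ennreal (u z) * indicator {z. ennreal (l / 2) < g z} z \<partial>lebesgue)"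
        using q True doubling_const_ge_1 by (simp add: mult.assoc[symmetric] ennreal_mult[symmetric])
      \<comment> \<open>The factor \<open>1 / l\<close> of the weak type bound lowers the exponent
        to \<open>q - 2\<close>, which is still integrable at 0 because
        \<open>q > 1\<close>.\<close>
      also have "q * l powr (q - 1) * (2 * D / l) = 2 * D * q * l powr (q - 2)"
        using True powr_diff[of l "q - 1" 1] by simp
      also have "ennreal (2 * D * q * l powr (q - 2)) *
          (\<integral>\<^sup>+z. g z * ennreal (u z) * indicator {z. ennreal (l / 2) < g z} z \<partial>lebesgue) =
          (\<integral>\<^sup>+z. ennreal (2 * D * q * l powr (q - 2)) * (g z * ennreal (u z) * indicator {z. ennreal (l / 2) < g z} z) \<partial>lebesgue)"
        by (subst nn_integral_cmult) auto
      also have "\<dots> = (\<integral>\<^sup>+x. ennreal (2 * D * q) * (ennreal (l powr (q - 2)) * indicator {l. 0 < l \<and> ennreal (l / 2) < g x} l * (g x * ennreal (u x))) \<partial>lebesgue)"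
        using True q doubling_const_ge_1
        by (intro nn_integral_cong) (auto simp: indicator_def ennreal_mult mult_ac)
      finally show ?thesis .
    qed simp
  qed
  also have "\<dots> = (\<integral>\<^sup>+x. \<integral>\<^sup>+l. ennreal (2 * D * q) * (ennreal (l powr (q - 2)) * indicator {l. 0 < l \<and> ennreal (l / 2) < g x} l * (g x * ennreal (u x))) \<partial>lborel \<partial>lebesgue)"
    by (rule P.Fubini') measurable
  also have "\<dots> = (\<integral>\<^sup>+x. ennreal (D * 2 powr q * q / (q - 1)) * (ennpowr (g x) q * ennreal (u x)) \<partial>lebesgue)"
  proof (rule nn_integral_cong)
    fix x
    have q': "0 < q - 1" using q by simp
    \<comment> \<open>In this form the inner integral over \<open>l\<close> is again a layer cake,
      for the value \<open>2 * g x\<close> and the exponent \<open>q - 1\<close>.\<close>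
    have *: "ennreal (l / 2) < g x \<longleftrightarrow> ennreal l < 2 * g x" if "0 < l" for l
      using that by (cases "g x") (auto simp: ennreal_less_iff ennreal_mult[symmetric] ennreal_mult_top simp flip: ennreal_numeral)
    have "(\<integral>\<^sup>+l. ennreal (2 * D * q) * (ennreal (l powr (q - 2)) * indicator {l. 0 < l \<and> ennreal (l / 2) < g x} l * (g x * ennreal (u x))) \<partial>lborel)
      = (\<integral>\<^sup>+l. ennreal (2 * D * q / (q - 1)) * (g x * ennreal (u x)) * (ennreal ((q - 1) * l powr (q - 1 - 1)) * indicator {l. 0 < l \<and> ennreal l < 2 * g x} l) \<partial>lborel)"
    proof (rule nn_integral_cong)
      fix l
      have "ennreal (2 * D * q) * ennreal (l powr (q - 2)) = ennreal (2 * D * q / (q - 1)) * ennreal ((q - 1) * l powr (q - 1 - 1))"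
        using q doubling_const_ge_1 by (simp flip: ennreal_mult)
      then show "ennreal (2 * D * q) * (ennreal (l powr (q - 2)) * indicator {l. 0 < l \<and> ennreal (l / 2) < g x} l * (g x * ennreal (u x)))
        = ennreal (2 * D * q / (q - 1)) * (g x * ennreal (u x)) * (ennreal ((q - 1) * l powr (q - 1 - 1)) * indicator {l. 0 < l \<and> ennreal l < 2 * g x} l)"
        using * by (auto simp: indicator_def mult_ac)
    qed
    also have "\<dots> = ennreal (2 * D * q / (q - 1)) * (g x * ennreal (u x)) * ennpowr (2 * g x) (q - 1)"
      unfolding nn_integral_powr_lessThan[of "q - 1" "2 * g x", symmetric, OF q'] by (rule nn_integral_cmult) measurable
    also have "\<dots> = ennreal (2 * D * q / (q - 1)) * ennreal (2 powr (q - 1)) * (ennpowr (g x) 1 * ennpowr (g x) (q - 1) * ennreal (u x))"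
      using q ennpowr_ennreal[of 2 "q - 1"] by (simp add: ennpowr_mult mult_ac)
    also have "ennpowr (g x) 1 * ennpowr (g x) (q - 1) = ennpowr (g x) q"
      by (subst ennpowr_add[symmetric]) simp
    also have "ennreal (2 * D * q / (q - 1)) * ennreal (2 powr (q - 1)) = ennreal (D * 2 powr q * q / (q - 1))"
    proof -
      have "2 powr q = 2 * 2 powr (q - 1)" by (simp add: powr_diff)
      then have "2 * D * q / (q - 1) * 2 powr (q - 1) = D * 2 powr q * q / (q - 1)" by simp
      moreover have "ennreal (2 * D * q / (q - 1)) * ennreal (2 powr (q - 1)) = ennreal (2 * D * q / (q - 1) * 2 powr (q - 1))"
        using q doubling_const_ge_1 by (intro ennreal_mult[symmetric]) auto
      ultimately show ?thesis by (simp only:)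
    qed
    finally show "(\<integral>\<^sup>+l. ennreal (2 * D * q) * (ennreal (l powr (q - 2)) * indicator {l. 0 < l \<and> ennreal (l / 2) < g x} l * (g x * ennreal (u x))) \<partial>lborel)
      = ennreal (D * 2 powr q * q / (q - 1)) * (ennpowr (g x) q * ennreal (u x))" .
  qed
  also have "\<dots> = ennreal (D * 2 powr q * q / (q - 1)) * (\<integral>\<^sup>+x. ennpowr (g x) q * ennreal (u x) \<partial>lebesgue)"
    by (rule nn_integral_cmult) measurable
  finally show ?thesis .
qed

end

subsection \<open>The averaging condition\<close>

text \<open>Jensen's inequality for a measure that need not have mass 1, obtained by integrating the
  tangent inequality at the mean of \<open>G\<close>.\<close>

lemma nn_integral_Jensen_powr:
  assumes [measurable]: "G \<in> borel_measurable M" and p: "1 < p" and fin: "emeasure M (space M) < \<infinity>"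
  shows "ennpowr (\<integral>\<^sup>+x. G x \<partial>M) p \<le> (\<integral>\<^sup>+x. ennpowr (G x) p \<partial>M) * ennpowr (emeasure M (space M)) (p - 1)"
proof (cases "emeasure M (space M) = 0")
  case True
  then have "(\<integral>\<^sup>+x. G x \<partial>M) = 0"
    by (simp add: nn_integral_0_iff_AE) (auto intro!: AE_I'[of "space M"] simp: null_sets_def)
  then show ?thesis by simp
next
  case nz: False
  then obtain V where V: "emeasure M (space M) = ennreal V" "0 < V"
    using fin by (cases "emeasure M (space M)") (auto simp: less_le)
  show ?thesis
  proof (cases "\<integral>\<^sup>+x. ennpowr (G x) p \<partial>M")
    case top
    then show ?thesis using V by (simp add: ennreal_top_mult)
  next
    case (real b)
    have tangent: "ennreal (p * m powr (p - 1)) * (\<integral>\<^sup>+x. G x \<partial>M) \<le> ennreal (b + (p - 1) * m powr p * V)"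
      if "0 < m" for m
    proof -
      have "ennreal (p * m powr (p - 1)) * (\<integral>\<^sup>+x. G x \<partial>M) = (\<integral>\<^sup>+x. ennreal (p * m powr (p - 1)) * G x \<partial>M)"
        by (subst nn_integral_cmult) auto
      also have "\<dots> \<le> (\<integral>\<^sup>+x. ennpowr (G x) p + ennreal ((p - 1) * m powr p) \<partial>M)"
        using ennpowr_tangent[OF p that] by (intro nn_integral_mono) auto
      also have "\<dots> = ennreal b + ennreal ((p - 1) * m powr p) * ennreal V"
        using real V by (subst nn_integral_add) auto
      also have "\<dots> = ennreal (b + (p - 1) * m powr p * V)"
        using p real V by (simp add: ennreal_mult)
      finally show ?thesis .
    qed
    have "(\<integral>\<^sup>+x. G x \<partial>M) \<noteq> top"
      \<comment> \<open>Any one tangent shows finiteness, so that the mean can be formed.\<close>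
      using tangent[of 1] p by (auto simp: ennreal_mult_top top_unique)
    then obtain j where j: "(\<integral>\<^sup>+x. G x \<partial>M) = ennreal j" "0 \<le> j"
      by (cases "\<integral>\<^sup>+x. G x \<partial>M") auto
    show ?thesis
    proof (cases "j = 0")
      case True
      then show ?thesis by (simp add: j)
    next
      case False
      \<comment> \<open>The tangent point is the mean of \<open>G\<close>; both linear terms then
        become multiples of \<open>m powr p * V\<close>, and their difference is the claim.\<close>
      define m where "m = j / V"
      have m: "0 < m" and jm: "j = m * V" using False j V by (auto simp: m_def)
      have "p * m powr (p - 1) * j \<le> b + (p - 1) * m powr p * V"
      proof -
        have "ennreal (p * m powr (p - 1) * j) \<le> ennreal (b + (p - 1) * m powr p * V)"
          using tangent[OF m] p j(2) by (simp only: j(1)) (subst ennreal_mult, auto)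
        then show ?thesis
          using p m V real by (subst (asm) ennreal_le_iff) auto
      qed
      moreover have "m powr (p - 1) * j = m powr p * V"
        using m by (simp add: jm powr_diff)
      ultimately have "p * (m powr p * V) \<le> b + (p - 1) * (m powr p * V)"
        by (simp only: mult.assoc)
      then have "m powr p * V \<le> b"
        by (simp add: left_diff_distrib)
      then have "m powr p * V * V powr (p - 1) \<le> b * V powr (p - 1)"
        by (intro mult_right_mono) auto
      moreover have "m powr p * V * V powr (p - 1) = j powr p"
        using m V by (simp add: jm powr_mult powr_diff)
      ultimately show ?thesis
        using real V j by (simp add: ennreal_mult[symmetric])
    qed
  qed
qed

lemma ennreal_divide_times_cancel: "0 < s \<Longrightarrow> x / ennreal s * ennreal s = x"
  by (simp add: ennreal_divide_times ennreal_divide_self)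

text \<open>With \<open>s\<close> the value of \<open>\<sigma>\<close> at a point,
  \<open>s powr (1 - p)\<close> is that of \<open>w\<close>. Thus the norm of
  \<open>g / \<sigma>\<close> in L_p(\<open>\<sigma>\<close>) is the norm of \<open>g\<close> in
  L_p(\<open>w\<close>).\<close>

lemma ennpowr_divide_times_dual:
  assumes "1 < p" "0 < s"
  shows "ennpowr (x / ennreal s) p * ennreal s = ennpowr x p * ennreal (s powr (1 - p))"
  using assms
  by (cases x) (auto simp: divide_ennreal ennreal_mult[symmetric] powr_divide powr_diff ennreal_top_divide ennreal_top_mult)

lemma conjugate_exponent_gt_1: "1 < p \<Longrightarrow> 1 < conjugate_exponent p"
  by (simp add: conjugate_exponent_def)

lemma conjugate_exponent_conjugate: "1 < p \<Longrightarrow> conjugate_exponent (conjugate_exponent p) = p"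
  by (simp add: conjugate_exponent_def field_simps)

lemma conjugate_exponent_minus_1: "1 < p \<Longrightarrow> conjugate_exponent p - 1 = 1 / (p - 1)"
  by (simp add: conjugate_exponent_def field_simps)

lemma conjugate_exponent_mult: "1 < p \<Longrightarrow> (p - 1) * conjugate_exponent p = p"
  by (simp add: conjugate_exponent_def)

context anisotropy begin

text \<open>Multiplied out to avoid quotients in \<open>ennreal\<close>. It makes sense for
  \<open>p = 1\<close> as well as for \<open>p > 1\<close>, so both parts of the theorem can share
  its consequences.\<close>

definition averaging :: "real \<Rightarrow> (real^'n \<Rightarrow> real) \<Rightarrow> real \<Rightarrow> bool" where
  "averaging p w C \<longleftrightarrow> (\<forall>x t. \<forall>g\<in>borel_measurable lebesgue. 0 < t \<longrightarrow>
     wmeasure w (pbox x t) * ennpowr (\<integral>\<^sup>+y\<in>pbox x t. g y \<partial>lebesgue) p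
     \<le> ennreal C * ennpowr (vol x t) p * (\<integral>\<^sup>+y\<in>pbox x t. (ennpowr (g y) p * ennreal (w y)) \<partial>lebesgue))"

lemma averagingD:
  assumes "averaging p w C" "g \<in> borel_measurable lebesgue" "0 < t"
  shows "wmeasure w (pbox x t) * ennpowr (\<integral>\<^sup>+y\<in>pbox x t. g y \<partial>lebesgue) p
     \<le> ennreal C * ennpowr (vol x t) p * (\<integral>\<^sup>+y\<in>pbox x t. (ennpowr (g y) p * ennreal (w y)) \<partial>lebesgue)"
  using assms by (auto simp: averaging_def)

text \<open>The condition on the dilated box is tested with the indicator of the original one; the
  volume ratio \<open>dil powr hom_dim\<close> enters with the power \<open>p\<close>. The maximum
  with 1 normalises the constant.\<close>

lemma doubling_weight_if_averaging:
  assumes avg: "averaging p w C" and [measurable]: "w \<in> borel_measurable lebesgue" and "1 \<le> p" "0 \<le> C"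
    and fin: "\<And>x t. 0 < t \<Longrightarrow> wmeasure w (pbox x t) < \<infinity>"
  shows "doubling_weight a w (max 1 (C * dil powr (hom_dim * p)))"
proof unfold_locales
  fix x and t :: real assume t: "0 < t"
  let ?E = "pbox x (dil * t)"
  have sub: "pbox x t \<subseteq> ?E"
    using t dil_gt_1 by (intro pbox_mono) auto
  have "(\<integral>\<^sup>+y\<in>?E. indicator (pbox x t) y \<partial>lebesgue) = (\<integral>\<^sup>+y. indicator (pbox x t) y \<partial>lebesgue)"
    using sub by (intro nn_integral_cong) (auto simp: indicator_def)
  then have 1: "(\<integral>\<^sup>+y\<in>?E. indicator (pbox x t) y \<partial>lebesgue) = vol x t"
    by (simp only: nn_integral_indicator sets_pbox)
  have 2: "(\<integral>\<^sup>+y\<in>?E. (ennpowr (indicator (pbox x t) y) p * ennreal (w y)) \<partial>lebesgue) = wmeasure w (pbox x t)"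
    unfolding wmeasure_def using sub ennpowr_ennreal[of 1 p] by (intro nn_integral_cong) (auto simp: indicator_def)
  obtain V where V: "vol x t = ennreal V" "0 < V"
    using t by (simp add: vol_eq del: emeasure_completion)
  have "ennpowr (vol x (dil * t)) p = ennreal (dil powr (hom_dim * p)) * ennreal (V powr p)"
    unfolding vol_dil[OF t] V(1) using \<open>1 \<le> p\<close> V(2) by (simp add: ennpowr_mult powr_powr)
  then have "wmeasure w ?E * ennreal (V powr p) \<le> ennreal C * (ennreal (dil powr (hom_dim * p)) * ennreal (V powr p)) * wmeasure w (pbox x t)"
    using averagingD[OF avg _, of "indicator (pbox x t)" "dil * t" x] t dil_pos V(2) unfolding 1 2 V(1) by simp
  also have "\<dots> = (ennreal (C * dil powr (hom_dim * p)) * wmeasure w (pbox x t)) * ennreal (V powr p)"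
    using \<open>0 \<le> C\<close> by (simp add: ennreal_mult mult_ac)
  finally have "wmeasure w ?E \<le> ennreal (C * dil powr (hom_dim * p)) * wmeasure w (pbox x t)"
    using V(2) ennreal_mult_le_mult_iff[of "ennreal (V powr p)"] by (simp add: mult.commute)
  also have "\<dots> \<le> ennreal (max 1 (C * dil powr (hom_dim * p))) * wmeasure w (pbox x t)"
    by (intro mult_right_mono) (auto intro: ennreal_leI)
  finally show "wmeasure w ?E \<le> ennreal (max 1 (C * dil powr (hom_dim * p))) * wmeasure w (pbox x t)" .
qed (use fin in auto)

lemma wmeasure_pbox_pos:
  assumes [measurable]: "w \<in> borel_measurable lebesgue" and pos: "AE x in lebesgue. 0 < w x" and "0 < t"
  shows "0 < wmeasure w (pbox x t)"
proof (rule ccontr)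
  assume "\<not> ?thesis"
  then have "(\<integral>\<^sup>+y. ennreal (w y) * indicator (pbox x t) y \<partial>lebesgue) = 0"
    by (simp add: wmeasure_def)
  then have "AE y in lebesgue. ennreal (w y) * indicator (pbox x t) y = 0"
    by (subst (asm) nn_integral_0_iff_AE) auto
  with pos have "AE y in lebesgue. y \<notin> pbox x t"
    by eventually_elim (auto simp: indicator_def ennreal_eq_0_iff split: if_splits)
  then have "vol x t = 0"
    by (subst (asm) AE_iff_measurable[of "pbox x t"]) (auto simp del: emeasure_completion)
  with vol_pos[OF \<open>0 < t\<close>, of x] show False by (simp del: emeasure_completion)
qed

end

subsection \<open>The anisotropic maximal function on weighted Lebesgue spaces\<close>

context anisotropy begin

text \<open>The operator \<open>maximal\<close> with values in \<open>ennreal\<close>. Its boxes are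
  centred at \<open>x\<close>, unlike those of \<open>wmax\<close>.\<close>

definition mmax :: "(real^'n \<Rightarrow> ennreal) \<Rightarrow> real^'n \<Rightarrow> ennreal" where
  "mmax g x = (SUP t\<in>{0<..}. (\<integral>\<^sup>+y\<in>pbox x t. g y \<partial>lebesgue) / vol x t)"

lemma mmax_level_set:
  "l < mmax g x \<longleftrightarrow> (\<exists>t>0. l < (\<integral>\<^sup>+y\<in>pbox x t. g y \<partial>lebesgue) / vol x t)"
  by (auto simp: mmax_def less_SUP_iff)

text \<open>An average above \<open>l\<close> survives a slight enlargement of the box, and the
  enlarged box about any nearby centre contains the original one. Measurability of
  \<open>mmax\<close> follows.\<close>

lemma open_mmax_level_set: "open {x. l < mmax g x}"
proof (rule openI, clarify)
  fix x assume "l < mmax g x"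
  then obtain t where t: "0 < t" "l < (\<integral>\<^sup>+y\<in>pbox x t. g y \<partial>lebesgue) / vol x t"
    by (auto simp: mmax_level_set)
  define I where "I = (\<integral>\<^sup>+y\<in>pbox x t. g y \<partial>lebesgue)"
  obtain r where r: "l = ennreal r" "0 \<le> r"
    using t(2) by (cases l) auto
  have "l * vol x t < I"
    using t vol_pos vol_finite by (simp add: I_def ennreal_less_divide_iff del: emeasure_completion)
  then have lt: "ennreal (r * (2 ^ CARD('n) * t powr hom_dim)) < I"
    using r t by (simp add: vol_eq ennreal_mult del: emeasure_completion)
  have "((\<lambda>s. ennreal (r * (2 ^ CARD('n) * s powr hom_dim))) \<longlongrightarrow> ennreal (r * (2 ^ CARD('n) * t powr hom_dim))) (at_right t)"
    using t by (intro tendsto_ennrealI tendsto_intros) auto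
  then have "\<forall>\<^sub>F s in at_right t. ennreal (r * (2 ^ CARD('n) * s powr hom_dim)) < I \<and> t < s"
    using lt eventually_at_right_less by (intro eventually_conj order_tendstoD(2)) auto
  then obtain s where s: "t < s" "ennreal (r * (2 ^ CARD('n) * s powr hom_dim)) < I"
    using eventually_happens'[OF trivial_limit_at_right_real] by blast
  \<comment> \<open>For a centre \<open>y\<close> in this neighbourhood the shift in each coordinate
    is smaller than the gain in half-side, so \<open>pbox y s\<close> contains
    \<open>pbox x t\<close>.\<close>
  define U where "U = box (x - (\<chi> i. s powr (a $ i) - t powr (a $ i))) (x + (\<chi> i. s powr (a $ i) - t powr (a $ i)))"
  have U: "y \<in> U \<longleftrightarrow> (\<forall>i. \<bar>y $ i - x $ i\<bar> < s powr (a $ i) - t powr (a $ i))" for y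
    unfolding U_def mem_box_cart by (intro all_cong1) (simp, linarith)
  have "x \<in> U"
    using s(1) t(1) a_pos by (auto simp: U powr_less_mono2)
  moreover have "U \<subseteq> {x. l < mmax g x}"
  proof
    fix y assume y: "y \<in> U"
    have "pbox x t \<subseteq> pbox y s"
    proof
      fix z assume z: "z \<in> pbox x t"
      have "\<bar>z $ i - y $ i\<bar> \<le> s powr (a $ i)" for i
        using y[unfolded U, rule_format, of i] z by (auto simp: parallelepiped_def dest!: spec[of _ i])
      then show "z \<in> pbox y s" by (auto simp: parallelepiped_def)
    qed
    then have "I \<le> (\<integral>\<^sup>+z\<in>pbox y s. g z \<partial>lebesgue)"
      unfolding I_def by (intro nn_integral_mono) (auto simp: indicator_def)
    then have "l * vol y s < (\<integral>\<^sup>+z\<in>pbox y s. g z \<partial>lebesgue)"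
      using s r t by (simp add: vol_eq ennreal_mult[symmetric] del: emeasure_completion)
    then have "l < (\<integral>\<^sup>+z\<in>pbox y s. g z \<partial>lebesgue) / vol y s"
      using s t vol_pos[of s] vol_finite[of s] by (simp add: ennreal_less_divide_iff del: emeasure_completion)
    then show "y \<in> {x. l < mmax g x}"
      unfolding mem_Collect_eq mmax_level_set using s t by (intro exI[of _ s]) auto
  qed
  moreover have "open U" unfolding U_def by (rule open_box)
  ultimately show "\<exists>e>0. ball x e \<subseteq> {x. l < mmax g x}"
    by (meson openE subset_trans)
qed

lemma measurable_mmax [measurable]: "mmax g \<in> borel_measurable lebesgue"
  by (rule borel_measurableI_greater) (use open_mmax_level_set in auto)

end

text \<open>The relation between the weights is required almost everywhere only, so that they can be
  exchanged: its inverse is available where \<open>w\<close> is positive. \<open>Ap\<close> is the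
  Muckenhoupt condition multiplied by the p-th power of the volume.\<close>

locale dual_weights = anisotropy a for a :: "real^'n" +
  fixes p :: real and w \<sigma> :: "real^'n \<Rightarrow> real" and C :: real
  assumes p: "1 < p"
    and measurable_w [measurable]: "w \<in> borel_measurable lebesgue"
    and measurable_\<sigma> [measurable]: "\<sigma> \<in> borel_measurable lebesgue"
    and w_pos: "AE x in lebesgue. 0 < w x"
    and \<sigma>_eq: "AE x in lebesgue. \<sigma> x = w x powr (1 - conjugate_exponent p)"
    and w_finite: "0 < t \<Longrightarrow> wmeasure w (pbox x t) < \<infinity>"
    and \<sigma>_finite: "0 < t \<Longrightarrow> wmeasure \<sigma> (pbox x t) < \<infinity>"
    and C: "1 \<le> C"
    and Ap: "0 < t \<Longrightarrow> wmeasure w (pbox x t) * ennpowr (wmeasure \<sigma> (pbox x t)) (p - 1) \<le> ennreal C * ennpowr (vol x t) p"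
begin

lemma \<sigma>_pos: "AE x in lebesgue. 0 < \<sigma> x"
  using w_pos \<sigma>_eq by eventually_elim auto

lemma w_eq: "AE x in lebesgue. w x = \<sigma> x powr (1 - p)"
  using w_pos \<sigma>_eq
proof eventually_elim
  case (elim x)
  have "(1 - conjugate_exponent p) * (1 - p) = 1"
    using p by (simp add: conjugate_exponent_def field_simps)
  then show ?case using elim by (simp add: powr_powr)
qed

text \<open>Raising the condition for \<open>w\<close> to the power \<open>1 / (p - 1)\<close> gives
  the condition for \<open>\<sigma>\<close> with the conjugate exponent.\<close>

lemma dual: "dual_weights a (conjugate_exponent p) \<sigma> w (C powr (1 / (p - 1)))"
proof unfold_locales
  fix x and t :: real assume t: "0 < t"
  let ?q = "conjugate_exponent p" and ?w = "wmeasure w (pbox x t)" and ?s = "wmeasure \<sigma> (pbox x t)"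
  have "ennpowr (?w * ennpowr ?s (p - 1)) (1 / (p - 1)) \<le> ennpowr (ennreal C * ennpowr (vol x t) p) (1 / (p - 1))"
    using p by (intro ennpowr_mono Ap t) auto
  moreover have "p * (1 / (p - 1)) = ?q" "(p - 1) * (1 / (p - 1)) = 1"
    using p by (auto simp: conjugate_exponent_def)
  ultimately show "?s * ennpowr ?w (?q - 1) \<le> ennreal (C powr (1 / (p - 1))) * ennpowr (vol x t) ?q"
    using p C by (simp add: ennpowr_mult ennpowr_ennpowr conjugate_exponent_minus_1 mult.commute del: emeasure_completion)
qed (use p C a_pos \<sigma>_pos w_eq w_finite \<sigma>_finite in
      \<open>auto simp: conjugate_exponent_gt_1 conjugate_exponent_conjugate ge_one_powr_ge_zero\<close>)

lemma nn_integral_dual: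
  assumes [measurable]: "g \<in> borel_measurable lebesgue" "S \<in> sets lebesgue"
  shows "(\<integral>\<^sup>+x\<in>S. (g x / ennreal (\<sigma> x) * ennreal (\<sigma> x)) \<partial>lebesgue) = (\<integral>\<^sup>+x\<in>S. g x \<partial>lebesgue)"
    and "(\<integral>\<^sup>+x\<in>S. (ennpowr (g x / ennreal (\<sigma> x)) p * ennreal (\<sigma> x)) \<partial>lebesgue) =
      (\<integral>\<^sup>+x\<in>S. (ennpowr (g x) p * ennreal (w x)) \<partial>lebesgue)"
proof -
  show "(\<integral>\<^sup>+x\<in>S. (g x / ennreal (\<sigma> x) * ennreal (\<sigma> x)) \<partial>lebesgue) = (\<integral>\<^sup>+x\<in>S. g x \<partial>lebesgue)"
    using \<sigma>_pos by (intro nn_integral_cong_AE, eventually_elim) (simp add: ennreal_divide_times_cancel)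
  show "(\<integral>\<^sup>+x\<in>S. (ennpowr (g x / ennreal (\<sigma> x)) p * ennreal (\<sigma> x)) \<partial>lebesgue) =
      (\<integral>\<^sup>+x\<in>S. (ennpowr (g x) p * ennreal (w x)) \<partial>lebesgue)"
    using \<sigma>_pos w_eq by (intro nn_integral_cong_AE, eventually_elim) (simp add: ennpowr_divide_times_dual p)
qed

text \<open>Jensen's inequality is applied to \<open>g / \<sigma>\<close> on the box with density
  \<open>\<sigma>\<close>; the Muckenhoupt condition then absorbs the power of the mass of
  \<open>\<sigma>\<close>.\<close>

lemma averaging: "averaging p w C"
  unfolding averaging_def
proof (intro allI ballI impI)
  fix x and t :: real and g :: "real^'n \<Rightarrow> ennreal"
  assume [measurable]: "g \<in> borel_measurable lebesgue" and t: "0 < t"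
  let ?E = "pbox x t" and ?I = "\<integral>\<^sup>+y\<in>pbox x t. (ennpowr (g y) p * ennreal (w y)) \<partial>lebesgue"
  define M where "M = density lebesgue (\<lambda>y. ennreal (\<sigma> y) * indicator ?E y)"
  have M: "(\<integral>\<^sup>+y. h y \<partial>M) = (\<integral>\<^sup>+y\<in>?E. (h y * ennreal (\<sigma> y)) \<partial>lebesgue)"
    if "h \<in> borel_measurable lebesgue" for h
    using that unfolding M_def by (subst nn_integral_density) (auto intro!: nn_integral_cong simp: mult_ac)
  have mass: "emeasure M (space M) = wmeasure \<sigma> ?E"
    using M[of "\<lambda>_. 1"] by (simp add: wmeasure_def)
  have "ennpowr (\<integral>\<^sup>+y. g y / ennreal (\<sigma> y) \<partial>M) p \<le>
      (\<integral>\<^sup>+y. ennpowr (g y / ennreal (\<sigma> y)) p \<partial>M) * ennpowr (emeasure M (space M)) (p - 1)"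
    using p \<sigma>_finite[OF t, of x] by (intro nn_integral_Jensen_powr) (auto simp: M_def[symmetric] mass, simp add: M_def)
  then have "ennpowr (\<integral>\<^sup>+y\<in>?E. g y \<partial>lebesgue) p \<le> ?I * ennpowr (wmeasure \<sigma> ?E) (p - 1)"
    by (simp add: M mass nn_integral_dual)
  then have "wmeasure w ?E * ennpowr (\<integral>\<^sup>+y\<in>?E. g y \<partial>lebesgue) p \<le> wmeasure w ?E * (?I * ennpowr (wmeasure \<sigma> ?E) (p - 1))"
    by (rule mult_left_mono) auto
  also have "\<dots> = wmeasure w ?E * ennpowr (wmeasure \<sigma> ?E) (p - 1) * ?I"
    by (simp add: mult_ac)
  also have "\<dots> \<le> ennreal C * ennpowr (vol x t) p * ?I"
    by (intro mult_right_mono Ap t) auto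
  finally show "wmeasure w ?E * ennpowr (\<integral>\<^sup>+y\<in>?E. g y \<partial>lebesgue) p \<le> ennreal C * ennpowr (vol x t) p * ?I" .
qed

lemma doubling_w: "doubling_weight a w (max 1 (C * dil powr (hom_dim * p)))"
  using p C by (intro doubling_weight_if_averaging[OF averaging] w_finite) auto

text \<open>Lerner's inequality. The \<open>\<sigma>\<close>-average of \<open>g / \<sigma>\<close>
  over a box is at most the inner maximal function throughout its interior. Integrating the power
  \<open>p - 1\<close> over the box and dividing by its \<open>w\<close>-mass gives at most a
  \<open>w\<close>-average of \<open>H\<close>, and the Muckenhoupt condition converts the
  normalisations.\<close>

lemma mmax_le_wmax_wmax:
  assumes [measurable]: "g \<in> borel_measurable lebesgue"
  defines "H \<equiv> \<lambda>y. ennpowr (wmax \<sigma> (\<lambda>z. g z / ennreal (\<sigma> z)) y) (p - 1) / ennreal (w y)"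
  shows "mmax g x \<le> ennpowr (ennreal C * wmax w H x) (1 / (p - 1))"
  unfolding mmax_def
proof (rule SUP_least, simp only: greaterThan_iff)
  fix t :: real assume t: "0 < t"
  let ?E = "pbox x t"
  define N where "N = wmax \<sigma> (\<lambda>z. g z / ennreal (\<sigma> z))"
  have [measurable]: "N \<in> borel_measurable lebesgue" unfolding N_def by (rule measurable_wmax)
  define I where "I = (\<integral>\<^sup>+y\<in>?E. g y \<partial>lebesgue)"
  obtain V where V: "vol x t = ennreal V" "0 < V"
    using t by (simp add: vol_eq del: emeasure_completion)
  obtain m where m: "wmeasure w ?E = ennreal m" "0 < m"
    using w_finite[OF t, of x] wmeasure_pbox_pos[OF measurable_w w_pos t, of x]
    by (cases "wmeasure w ?E") auto
  obtain s where s: "wmeasure \<sigma> ?E = ennreal s" "0 < s"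
    using \<sigma>_finite[OF t, of x] wmeasure_pbox_pos[OF measurable_\<sigma> \<sigma>_pos t, of x]
    by (cases "wmeasure \<sigma> ?E") auto
  have N: "I / ennreal s \<le> N y" if "y \<in> interior ?E" for y
    using wmax_ge[OF t that, of "\<lambda>z. g z / ennreal (\<sigma> z)" \<sigma>]
    by (simp add: nn_integral_dual(1) s N_def I_def)
  \<comment> \<open>The interior has the full volume, so it does no harm that the bound by
    \<open>N\<close> is known only there.\<close>
  have "ennpowr (I / ennreal s) (p - 1) * ennreal V
      = (\<integral>\<^sup>+y. ennpowr (I / ennreal s) (p - 1) * indicator (interior ?E) y \<partial>lebesgue)"
    by (subst nn_integral_cmult_indicator) (simp_all add: emeasure_interior_pbox V del: emeasure_completion)
  also have "\<dots> \<le> (\<integral>\<^sup>+y\<in>?E. ennpowr (N y) (p - 1) \<partial>lebesgue)"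
    using N p interior_subset[of ?E]
    by (intro nn_integral_mono) (auto simp: indicator_def intro!: ennpowr_mono)
  also have "\<dots> = (\<integral>\<^sup>+y\<in>?E. (H y * ennreal (w y)) \<partial>lebesgue)"
    unfolding H_def N_def[symmetric]
    using w_pos by (intro nn_integral_cong_AE, eventually_elim) (simp add: ennreal_divide_times_cancel)
  finally have "ennpowr (I / ennreal s) (p - 1) * ennreal V / ennreal m
      \<le> (\<integral>\<^sup>+y\<in>?E. (H y * ennreal (w y)) \<partial>lebesgue) / ennreal m"
    by (rule divide_right_mono_ennreal)
  also have "\<dots> \<le> wmax w H x"
    using wmax_ge[OF t center_mem_interior_pbox[OF t, of x], of H w] by (simp add: m)
  finally have *: "ennreal C * (ennpowr (I / ennreal s) (p - 1) * ennreal V / ennreal m) \<le> ennreal C * wmax w H x"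
    by (rule mult_left_mono) auto
  have "ennpowr (I / ennreal V) (p - 1) \<le> ennreal C * (ennpowr (I / ennreal s) (p - 1) * ennreal V / ennreal m)"
  proof (cases I)
    case (real i)
    \<comment> \<open>This is \<open>Ap\<close> in real numbers; it trades the normalisation by
      \<open>s\<close> and \<open>m\<close> for the one by \<open>V\<close>.\<close>
    have "m * s powr (p - 1) \<le> C * V powr p"
      using Ap[OF t, of x] s m V C by (simp add: ennreal_mult[symmetric])
    then have "m * s powr (p - 1) \<le> C * V * V powr (p - 1)"
      using V by (simp add: powr_diff)
    then have "1 / V powr (p - 1) \<le> C * V / (s powr (p - 1) * m)"
      using V m s by (simp add: field_simps)
    then have "i powr (p - 1) * (1 / V powr (p - 1)) \<le> i powr (p - 1) * (C * V / (s powr (p - 1) * m))"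
      by (rule mult_left_mono) auto
    then have "(i / V) powr (p - 1) \<le> C * ((i / s) powr (p - 1) * V / m)"
      using real V s by (simp add: powr_divide mult_ac)
    then show ?thesis
      using real V s m C by (simp add: divide_ennreal ennreal_mult[symmetric])
  next
    case top
    then show ?thesis
      using V s m C by (simp add: ennreal_top_divide ennreal_top_mult ennreal_mult_top)
  qed
  also note *
  finally have "ennpowr (ennpowr (I / ennreal V) (p - 1)) (1 / (p - 1)) \<le> ennpowr (ennreal C * wmax w H x) (1 / (p - 1))"
    using p by (intro ennpowr_mono) auto
  then show "(\<integral>\<^sup>+y\<in>?E. g y \<partial>lebesgue) / vol x t \<le> ennpowr (ennreal C * wmax w H x) (1 / (p - 1))"
    using p by (simp add: ennpowr_ennpowr I_def V del: emeasure_completion)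
qed

text \<open>By Lerner's inequality two weighted maximal functions remain: the outer one is bounded
  for \<open>w\<close> with the conjugate exponent, the inner one for \<open>\<sigma>\<close> with
  \<open>p\<close>. Both weights are doubling, so interpolation applies to each.\<close>

theorem mmax_strong:
  obtains K where "0 < K" "\<And>g. g \<in> borel_measurable lebesgue \<Longrightarrow>
    (\<integral>\<^sup>+x. ennpowr (mmax g x) p * ennreal (w x) \<partial>lebesgue) \<le> ennreal K * (\<integral>\<^sup>+x. ennpowr (g x) p * ennreal (w x) \<partial>lebesgue)"
proof -
  let ?q = "conjugate_exponent p"
  have q: "1 < ?q" using p by (rule conjugate_exponent_gt_1)
  interpret D: dual_weights a ?q \<sigma> w "C powr (1 / (p - 1))" by (rule dual)
  define A where "A = max 1 (C * dil powr (hom_dim * p))"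
  define B where "B = max 1 (C powr (1 / (p - 1)) * dil powr (hom_dim * ?q))"
  interpret W: doubling_weight a w A unfolding A_def by (rule doubling_w)
  interpret S: doubling_weight a \<sigma> B unfolding B_def by (rule D.doubling_w)
  have AB: "1 \<le> A" "1 \<le> B" by (auto simp: A_def B_def)
  define K1 where "K1 = A * 2 powr ?q * ?q / (?q - 1)"
  define K2 where "K2 = B * 2 powr p * p / (p - 1)"
  have K: "0 < K1" "0 < K2" using AB p q by (auto simp: K1_def K2_def intro!: divide_pos_pos mult_pos_pos)
  show ?thesis
  proof
    show "0 < C powr ?q * K1 * K2" using K C by simp
  next
    fix g :: "real^'n \<Rightarrow> ennreal" assume [measurable]: "g \<in> borel_measurable lebesgue"
    define N where "N = wmax \<sigma> (\<lambda>z. g z / ennreal (\<sigma> z))"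
    have [measurable]: "N \<in> borel_measurable lebesgue" unfolding N_def by (rule measurable_wmax)
    define H where "H = (\<lambda>y. ennpowr (N y) (p - 1) / ennreal (w y))"
    have [measurable]: "H \<in> borel_measurable lebesgue" unfolding H_def by measurable
    have "ennpowr (mmax g x) p \<le> ennreal (C powr ?q) * ennpowr (wmax w H x) ?q" for x
    proof -
      have "mmax g x \<le> ennpowr (ennreal C * wmax w H x) (1 / (p - 1))"
        using mmax_le_wmax_wmax[of g x] by (simp add: H_def N_def)
      then have "ennpowr (mmax g x) p \<le> ennpowr (ennpowr (ennreal C * wmax w H x) (1 / (p - 1))) p"
        using p by (intro ennpowr_mono) auto
      also have "\<dots> = ennpowr (ennreal C * wmax w H x) ?q"
        by (simp add: ennpowr_ennpowr conjugate_exponent_def)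
      finally show ?thesis using q C by (simp add: ennpowr_mult)
    qed
    then have 1: "(\<integral>\<^sup>+x. ennpowr (mmax g x) p * ennreal (w x) \<partial>lebesgue) \<le>
        (\<integral>\<^sup>+x. ennreal (C powr ?q) * (ennpowr (wmax w H x) ?q * ennreal (w x)) \<partial>lebesgue)"
      by (intro nn_integral_mono) (auto simp: mult.assoc[symmetric] intro: mult_right_mono)
    have 2: "\<dots> = ennreal (C powr ?q) * (\<integral>\<^sup>+x. ennpowr (wmax w H x) ?q * ennreal (w x) \<partial>lebesgue)"
      by (rule nn_integral_cmult) measurable
    have 3: "(\<integral>\<^sup>+x. ennpowr (wmax w H x) ?q * ennreal (w x) \<partial>lebesgue) \<le>
        ennreal K1 * (\<integral>\<^sup>+x. ennpowr (H x) ?q * ennreal (w x) \<partial>lebesgue)"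
      unfolding K1_def by (rule W.wmax_strong) (use q in auto)
    have "(\<integral>\<^sup>+x. ennpowr (H x) ?q * ennreal (w x) \<partial>lebesgue) = (\<integral>\<^sup>+x. ennpowr (N x) p * ennreal (\<sigma> x) \<partial>lebesgue)"
      \<comment> \<open>The duality identity with the weights exchanged;
        \<open>(p - 1) * conjugate_exponent p = p\<close> makes the exponent of \<open>N\<close>
        equal to \<open>p\<close>.\<close>
      using D.nn_integral_dual(2)[of "\<lambda>x. ennpowr (N x) (p - 1)" UNIV]
      by (simp add: H_def ennpowr_ennpowr conjugate_exponent_mult p)
    also have "\<dots> \<le> ennreal K2 * (\<integral>\<^sup>+x. ennpowr (g x / ennreal (\<sigma> x)) p * ennreal (\<sigma> x) \<partial>lebesgue)"
      unfolding K2_def N_def by (rule S.wmax_strong) (use p in auto)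
    also have "(\<integral>\<^sup>+x. ennpowr (g x / ennreal (\<sigma> x)) p * ennreal (\<sigma> x) \<partial>lebesgue) = (\<integral>\<^sup>+x. ennpowr (g x) p * ennreal (w x) \<partial>lebesgue)"
      using nn_integral_dual(2)[of g UNIV] by simp
    finally have 4: "(\<integral>\<^sup>+x. ennpowr (H x) ?q * ennreal (w x) \<partial>lebesgue) \<le> ennreal K2 * (\<integral>\<^sup>+x. ennpowr (g x) p * ennreal (w x) \<partial>lebesgue)" .
    have "(\<integral>\<^sup>+x. ennpowr (mmax g x) p * ennreal (w x) \<partial>lebesgue) \<le>
        ennreal (C powr ?q) * (ennreal K1 * (ennreal K2 * (\<integral>\<^sup>+x. ennpowr (g x) p * ennreal (w x) \<partial>lebesgue)))"
      using 1[unfolded 2] order_trans[OF 3 mult_left_mono[OF 4]] by (meson mult_left_mono order_trans zero_le)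
    then show "(\<integral>\<^sup>+x. ennpowr (mmax g x) p * ennreal (w x) \<partial>lebesgue)
        \<le> ennreal (C powr ?q * K1 * K2) * (\<integral>\<^sup>+x. ennpowr (g x) p * ennreal (w x) \<partial>lebesgue)"
      using K by (simp add: ennreal_mult mult.assoc)
  qed
qed

end

subsection \<open>Morrey spaces\<close>

locale averaging_weight = doubling_weight a w D for a :: "real^'n" and w :: "real^'n \<Rightarrow> real" and D :: real +
  fixes p \<kappa> C :: real
  assumes p: "1 \<le> p" and \<kappa>: "0 < \<kappa>" "\<kappa> < 1" and C: "1 \<le> C"
    and weight_pos: "AE x in lebesgue. 0 < w x"
    and averaging: "averaging p w C"
begin

lemma obtain_mass:
  assumes "0 < t" obtains m where "wmeasure w (pbox x t) = ennreal m" "0 < m"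
  using wmeasure_pbox_finite[OF assms, of x] wmeasure_pbox_pos[OF measurable_weight weight_pos assms, of x] that
  by (cases "wmeasure w (pbox x t)") auto

text \<open>Every box has weight strictly between 0 and infinity, so the quotient and the root in
  the norm can be cleared box by box.\<close>

lemma morrey_norm_le_iff:
  assumes "0 \<le> N"
  shows "morrey_norm a p \<kappa> w f \<le> ennreal N \<longleftrightarrow> (\<forall>x t. 0 < t \<longrightarrow>
    (\<integral>\<^sup>+y\<in>pbox x t. (ennpowr (emod f y) p * ennreal (w y)) \<partial>lebesgue)
      \<le> ennreal (N powr p) * ennpowr (wmeasure w (pbox x t)) \<kappa>)"
proof -
  have "ennpowr (J / ennpowr (wmeasure w (pbox x t)) \<kappa>) (1 / p) \<le> ennreal N \<longleftrightarrow>
      J \<le> ennreal (N powr p) * ennpowr (wmeasure w (pbox x t)) \<kappa>" if t: "0 < t" for x t J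
  proof -
    obtain m where m: "wmeasure w (pbox x t) = ennreal m" "0 < m" by (rule obtain_mass[OF t])
    show ?thesis
    proof (cases J)
      case (real j)
      have "(j / m powr \<kappa>) powr (1 / p) \<le> N \<longleftrightarrow> j / m powr \<kappa> \<le> N powr p"
      proof
        assume "(j / m powr \<kappa>) powr (1 / p) \<le> N"
        then have "((j / m powr \<kappa>) powr (1 / p)) powr p \<le> N powr p"
          using p by (intro powr_mono2) auto
        then show "j / m powr \<kappa> \<le> N powr p"
          using p real m by (simp add: powr_powr)
      next
        assume "j / m powr \<kappa> \<le> N powr p"
        then have "(j / m powr \<kappa>) powr (1 / p) \<le> (N powr p) powr (1 / p)"
          using p real m by (intro powr_mono2) auto
        then show "(j / m powr \<kappa>) powr (1 / p) \<le> N"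
          using p assms by (simp add: powr_powr)
      qed
      then show ?thesis
        using real m assms by (simp add: divide_ennreal ennreal_mult[symmetric] pos_divide_le_eq)
    next
      case top
      then show ?thesis
        using m by (simp add: ennreal_top_divide ennreal_mult[symmetric] top_unique)
    qed
  qed
  then show ?thesis
    unfolding morrey_norm_def parallelepipeds_def wmeasure_def[symmetric] SUP_le_iff by blast
qed

text \<open>The averaging condition and the Morrey bound control the p-th power of the average by
  the weight of the large box to the power \<open>\<kappa> - 1\<close>. Since the small box lies in
  the dilate of the large one, doubling allows a comparison of their weights.\<close>

lemma average_le_of_large:
  assumes [measurable]: "g \<in> borel_measurable lebesgue" and B: "0 \<le> B"
    and g: "\<And>x t. 0 < t \<Longrightarrow> (\<integral>\<^sup>+y\<in>pbox x t. (ennpowr (g y) p * ennreal (w y)) \<partial>lebesgue)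
      \<le> ennreal B * ennpowr (wmeasure w (pbox x t)) \<kappa>"
    and r: "0 < r" "r < t" and x: "x \<in> pbox x0 r" and m: "wmeasure w (pbox x0 r) = ennreal m" "0 < m"
  shows "(\<integral>\<^sup>+y\<in>pbox x t. g y \<partial>lebesgue) / vol x t \<le> ennreal ((C * D * B * m powr (\<kappa> - 1)) powr (1 / p))"
proof -
  have t: "0 < t" using r by simp
  obtain m' where m': "wmeasure w (pbox x t) = ennreal m'" "0 < m'" by (rule obtain_mass[OF t])
  obtain V where V: "vol x t = ennreal V" "0 < V"
    using t by (simp add: vol_eq del: emeasure_completion)
  define I where "I = (\<integral>\<^sup>+y\<in>pbox x t. g y \<partial>lebesgue)"
  have "x \<in> pbox x t \<inter> pbox x0 r"
    using x t center_mem_pbox by auto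
  then have "pbox x0 r \<subseteq> pbox x (dil * t)"
    using r by (intro pbox_engulf) auto
  then have "ennreal m \<le> ennreal D * ennreal m'"
    unfolding m(1)[symmetric] m'(1)[symmetric] using doubling[OF t] wmeasure_mono order_trans by blast
  then have mm': "m \<le> D * m'"
    using m' doubling_const_ge_1 by (simp add: ennreal_mult[symmetric])
  have "ennreal m' * ennpowr I p \<le> ennreal C * ennpowr (vol x t) p *
      (\<integral>\<^sup>+y\<in>pbox x t. (ennpowr (g y) p * ennreal (w y)) \<partial>lebesgue)"
    using averagingD[OF averaging _ t, of g x] by (simp add: m' I_def del: emeasure_completion)
  also have "\<dots> \<le> ennreal C * ennpowr (vol x t) p * (ennreal B * ennpowr (ennreal m') \<kappa>)"
    using g[OF t, of x] by (intro mult_left_mono) (auto simp: m')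
  also have "\<dots> = ennreal (C * V powr p * B * m' powr \<kappa>)"
    using C V B m' by (simp add: ennreal_mult[symmetric] mult.assoc del: emeasure_completion)
  finally have main: "ennreal m' * ennpowr I p \<le> ennreal (C * V powr p * B * m' powr \<kappa>)" .
  show ?thesis
  proof (cases I)
    case (real i)
    have "m' * i powr p \<le> C * V powr p * B * m' powr \<kappa>"
      using main real m' C B by (simp add: ennreal_mult[symmetric])
    then have "(i / V) powr p \<le> C * B * (m' powr \<kappa> / m')"
      using m' V real by (simp add: powr_divide field_simps)
    also have "m' powr \<kappa> / m' = m' powr (\<kappa> - 1)"
      using m' by (simp add: powr_diff)
    \<comment> \<open>Here \<open>\<kappa> < 1\<close> enters: the power decreases with the mass,
      \<open>m\<close> is at most \<open>D * m'\<close>, and \<open>D powr (1 - \<kappa>)\<close> is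
      rounded up to \<open>D\<close>.\<close>
    also have "C * B * m' powr (\<kappa> - 1) \<le> C * B * (D * m powr (\<kappa> - 1))"
    proof (rule mult_left_mono)
      have "m powr (1 - \<kappa>) \<le> (D * m') powr (1 - \<kappa>)"
        using mm' m \<kappa> by (intro powr_mono2) auto
      also have "\<dots> = D powr (1 - \<kappa>) * m' powr (1 - \<kappa>)"
        using doubling_const_ge_1 m' by (simp add: powr_mult)
      also have "\<dots> \<le> D * m' powr (1 - \<kappa>)"
        using doubling_const_ge_1 \<kappa> powr_mono[of "1 - \<kappa>" 1 D] by (intro mult_right_mono) auto
      finally have "1 / m' powr (1 - \<kappa>) \<le> D * (1 / m powr (1 - \<kappa>))"
        using m m' by (simp add: field_simps)
      moreover have "1 / z powr (1 - \<kappa>) = z powr (\<kappa> - 1)" if "0 < z" for z :: real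
        using that powr_minus_divide[of z "1 - \<kappa>"] by simp
      ultimately show "m' powr (\<kappa> - 1) \<le> D * m powr (\<kappa> - 1)"
        using m m' by simp
    qed (use C B in auto)
    finally have "((i / V) powr p) powr (1 / p) \<le> (C * D * B * m powr (\<kappa> - 1)) powr (1 / p)"
      using p V real by (intro powr_mono2) (auto simp: mult_ac)
    then show ?thesis
      using p V real by (simp add: I_def[symmetric] divide_ennreal powr_powr del: emeasure_completion)
  next
    case top
    then show ?thesis using main m' by (simp add: ennreal_mult_top top_unique)
  qed
qed

text \<open>A box of parameter at most \<open>r\<close> about a point of \<open>pbox x0 r\<close>
  stays inside the dilate of \<open>pbox x0 r\<close>, so the cut-off leaves its average unchanged.
  Larger boxes are left to \<open>F\<close>.\<close>

lemma mmax_le_local: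
  assumes r: "0 < r" and x: "x \<in> pbox x0 r"
    and large: "\<And>t. r < t \<Longrightarrow> (\<integral>\<^sup>+y\<in>pbox x t. g y \<partial>lebesgue) / vol x t \<le> F"
  shows "mmax g x \<le> max (mmax (\<lambda>y. g y * indicator (pbox x0 (dil * r)) y) x) F"
  unfolding mmax_def[of g]
proof (rule SUP_least, simp only: greaterThan_iff)
  fix t :: real assume t: "0 < t"
  let ?g = "\<lambda>y. g y * indicator (pbox x0 (dil * r)) y"
  show "(\<integral>\<^sup>+y\<in>pbox x t. g y \<partial>lebesgue) / vol x t \<le> max (mmax ?g x) F"
  proof (cases "r < t")
    case True
    then show ?thesis using large by (simp add: le_max_iff_disj)
  next
    case False
    have "x \<in> pbox x0 r \<inter> pbox x t"
      using x t center_mem_pbox by auto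
    then have "pbox x t \<subseteq> pbox x0 (dil * r)"
      using t False by (intro pbox_engulf) auto
    then have "(\<integral>\<^sup>+y\<in>pbox x t. g y \<partial>lebesgue) = (\<integral>\<^sup>+y\<in>pbox x t. ?g y \<partial>lebesgue)"
      by (intro nn_integral_cong) (auto simp: indicator_def)
    also have "\<dots> / vol x t \<le> mmax ?g x"
      unfolding mmax_def using t by (intro SUP_upper) auto
    finally show ?thesis by (simp add: le_max_iff_disj)
  qed
qed

lemma ennpowr_wmeasure_dil_le:
  assumes r: "0 < r" and m: "wmeasure w (pbox x r) = ennreal m" "0 < m"
  shows "ennpowr (wmeasure w (pbox x (dil * r))) \<kappa> \<le> ennreal (D * m powr \<kappa>)"
proof -
  have "ennpowr (wmeasure w (pbox x (dil * r))) \<kappa> \<le> ennpowr (ennreal D * ennreal m) \<kappa>"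
    using doubling[OF r, of x] \<kappa> by (intro ennpowr_mono) (auto simp: m)
  also have "\<dots> = ennreal (D powr \<kappa> * m powr \<kappa>)"
    using doubling_const_ge_1 m \<kappa> by (simp add: ennpowr_mult ennreal_mult)
  also have "\<dots> \<le> ennreal (D * m powr \<kappa>)"
    using doubling_const_ge_1 \<kappa> powr_mono[of \<kappa> 1 D] by (intro ennreal_leI mult_right_mono) auto
  finally show ?thesis .
qed

text \<open>The strong type bound on the whole space and doubling handle the local part and
  contribute \<open>K * D\<close>. The large boxes contribute the constant \<open>F\<close>; the
  weight of the box times \<open>F powr p\<close> accounts for \<open>C * D\<close>.\<close>

proposition mmax_morrey_strong:
  assumes [measurable]: "g \<in> borel_measurable lebesgue" and B: "0 \<le> B"
    and g: "\<And>x t. 0 < t \<Longrightarrow> (\<integral>\<^sup>+y\<in>pbox x t. (ennpowr (g y) p * ennreal (w y)) \<partial>lebesgue)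
      \<le> ennreal B * ennpowr (wmeasure w (pbox x t)) \<kappa>"
    and strong: "\<And>h. h \<in> borel_measurable lebesgue \<Longrightarrow>
      (\<integral>\<^sup>+x. ennpowr (mmax h x) p * ennreal (w x) \<partial>lebesgue) \<le> ennreal K * (\<integral>\<^sup>+x. ennpowr (h x) p * ennreal (w x) \<partial>lebesgue)"
    and K: "0 < K" and r: "0 < r"
  shows "(\<integral>\<^sup>+y\<in>pbox x r. (ennpowr (mmax g y) p * ennreal (w y)) \<partial>lebesgue)
      \<le> ennreal ((K * D + C * D) * B) * ennpowr (wmeasure w (pbox x r)) \<kappa>"
proof -
  obtain m where m: "wmeasure w (pbox x r) = ennreal m" "0 < m" by (rule obtain_mass[OF r])
  define F where "F = (C * D * B * m powr (\<kappa> - 1)) powr (1 / p)"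
  have F: "F powr p = C * D * B * m powr (\<kappa> - 1)"
    using p C B doubling_const_ge_1 by (simp add: F_def powr_powr)
  have "0 \<le> F" by (simp add: F_def)
  let ?g = "\<lambda>y. g y * indicator (pbox x (dil * r)) y"
  have pw: "ennpowr (mmax g y) p \<le> ennpowr (mmax ?g y) p + ennreal (F powr p)" if "y \<in> pbox x r" for y
  proof -
    have "mmax g y \<le> max (mmax ?g y) (ennreal F)"
      unfolding F_def by (rule mmax_le_local[OF r that average_le_of_large]) (use B g r that m in auto)
    then have "ennpowr (mmax g y) p \<le> ennpowr (max (mmax ?g y) (ennreal F)) p"
      using p by (intro ennpowr_mono) auto
    also have "\<dots> \<le> ennpowr (mmax ?g y) p + ennreal (F powr p)"
      using \<open>0 \<le> F\<close> by (auto simp: max_def)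
    finally show ?thesis .
  qed
  have "(\<integral>\<^sup>+y\<in>pbox x r. (ennpowr (mmax g y) p * ennreal (w y)) \<partial>lebesgue) \<le>
      (\<integral>\<^sup>+y. ennpowr (mmax ?g y) p * ennreal (w y) + ennreal (F powr p) * (ennreal (w y) * indicator (pbox x r) y) \<partial>lebesgue)"
    using pw by (intro nn_integral_mono) (auto simp: indicator_def distrib_right[symmetric] intro!: mult_right_mono)
  also have "\<dots> = (\<integral>\<^sup>+y. ennpowr (mmax ?g y) p * ennreal (w y) \<partial>lebesgue) + ennreal (F powr p) * ennreal m"
    unfolding m(1)[symmetric] wmeasure_def by (subst nn_integral_add) (auto simp: nn_integral_cmult)
  also have "\<dots> \<le> ennreal K * (ennreal B * ennreal (D * m powr \<kappa>)) + ennreal (F powr p) * ennreal m"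
  proof (intro add_mono order_refl)
    have "(\<integral>\<^sup>+y. ennpowr (?g y) p * ennreal (w y) \<partial>lebesgue) =
        (\<integral>\<^sup>+y\<in>pbox x (dil * r). (ennpowr (g y) p * ennreal (w y)) \<partial>lebesgue)"
      by (intro nn_integral_cong) (auto simp: indicator_def)
    also have "\<dots> \<le> ennreal B * ennpowr (wmeasure w (pbox x (dil * r))) \<kappa>"
      using r dil_pos by (intro g) auto
    also have "\<dots> \<le> ennreal B * ennreal (D * m powr \<kappa>)"
      by (intro mult_left_mono ennpowr_wmeasure_dil_le r m) auto
    finally have "ennreal K * (\<integral>\<^sup>+y. ennpowr (?g y) p * ennreal (w y) \<partial>lebesgue) \<le> ennreal K * (ennreal B * ennreal (D * m powr \<kappa>))"
      by (rule mult_left_mono) auto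
    then show "(\<integral>\<^sup>+y. ennpowr (mmax ?g y) p * ennreal (w y) \<partial>lebesgue) \<le> ennreal K * (ennreal B * ennreal (D * m powr \<kappa>))"
      using strong[of ?g] by (rule order_trans[rotated]) measurable
  qed
  also have "\<dots> = ennreal (K * (B * (D * m powr \<kappa>)) + F powr p * m)"
    using K B doubling_const_ge_1 m by (simp add: ennreal_mult)
  also have "K * (B * (D * m powr \<kappa>)) + F powr p * m = (K * D + C * D) * B * m powr \<kappa>"
    using m(2) unfolding F by (simp add: powr_diff algebra_simps)
  also have "ennreal \<dots> = ennreal ((K * D + C * D) * B) * ennpowr (wmeasure w (pbox x r)) \<kappa>"
    using K B C doubling_const_ge_1 m by (simp add: ennreal_mult'')
  finally show ?thesis .
qed

text \<open>For \<open>p = 1\<close> the averaging condition says that an unweighted average is at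
  most \<open>C\<close> times the weighted average over the same box, whose centre is an interior
  point.\<close>

lemma mmax_le_wmax:
  assumes p1: "p = 1" and [measurable]: "g \<in> borel_measurable lebesgue"
  shows "mmax g x \<le> ennreal C * wmax w g x"
  unfolding mmax_def
proof (rule SUP_least, simp only: greaterThan_iff)
  fix t :: real assume t: "0 < t"
  obtain m where m: "wmeasure w (pbox x t) = ennreal m" "0 < m" by (rule obtain_mass[OF t])
  obtain V where V: "vol x t = ennreal V" "0 < V"
    using t by (simp add: vol_eq del: emeasure_completion)
  let ?I = "\<integral>\<^sup>+y\<in>pbox x t. g y \<partial>lebesgue" and ?J = "\<integral>\<^sup>+y\<in>pbox x t. (g y * ennreal (w y)) \<partial>lebesgue"
  have main: "ennreal m * ?I \<le> ennreal C * ennreal V * ?J"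
    using averagingD[OF averaging _ t, of g x] by (simp add: p1 m V del: emeasure_completion)
  have "?I / ennreal V \<le> ennreal C * (?J / ennreal m)"
  proof (cases ?J)
    case (real j)
    show ?thesis
    proof (cases ?I)
      case (real i)
      have "m * i \<le> C * V * j"
        using main real \<open>?J = ennreal j\<close> \<open>0 \<le> j\<close> m V C by (simp add: ennreal_mult[symmetric])
      then have "i / V \<le> C * (j / m)"
        using m V by (simp add: field_simps)
      then show ?thesis
        using real \<open>?J = ennreal j\<close> \<open>0 \<le> j\<close> m V C by (simp add: ennreal_mult[symmetric] divide_ennreal)
    next
      case top
      then show ?thesis
        using main real m C V by (simp add: ennreal_mult_top ennreal_mult[symmetric] top_unique)
    qed
  next
    case top
    then show ?thesis
      using m C by (simp add: ennreal_top_divide ennreal_mult_top)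
  qed
  also have "\<dots> \<le> ennreal C * wmax w g x"
    using wmax_ge[OF t center_mem_interior_pbox[OF t, of x], of g w] by (intro mult_left_mono) (auto simp: m)
  finally show "?I / vol x t \<le> ennreal C * wmax w g x"
    by (simp only: V)
qed

text \<open>If \<open>l < F\<close>, the weight of the whole box is small enough, since its product
  with \<open>F\<close> is a multiple of its power \<open>\<kappa>\<close>. Otherwise values above
  \<open>l\<close> come from the local part alone, and the weak type bound at height
  \<open>l / C\<close> applies. One factor \<open>D\<close> stems from that bound, the other from
  the weight of the dilate.\<close>

proposition mmax_morrey_weak:
  assumes p1: "p = 1" and [measurable]: "g \<in> borel_measurable lebesgue" and B: "0 \<le> B"
    and g: "\<And>x t. 0 < t \<Longrightarrow> (\<integral>\<^sup>+y\<in>pbox x t. (g y * ennreal (w y)) \<partial>lebesgue)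
      \<le> ennreal B * ennpowr (wmeasure w (pbox x t)) \<kappa>"
    and r: "0 < r" and l: "0 < l"
  shows "wmeasure w {y\<in>pbox x r. ennreal l < mmax g y} \<le> ennreal (C * D ^ 2 / l) * ennreal B * ennpowr (wmeasure w (pbox x r)) \<kappa>"
proof -
  obtain m where m: "wmeasure w (pbox x r) = ennreal m" "0 < m" by (rule obtain_mass[OF r])
  define F where "F = C * D * B * m powr (\<kappa> - 1)"
  have rhs: "ennreal (C * D ^ 2 / l) * ennreal B * ennpowr (wmeasure w (pbox x r)) \<kappa> = ennreal (C * D ^ 2 / l * B * m powr \<kappa>)"
    using C B l m doubling_const_ge_1 by (simp add: ennreal_mult[symmetric])
  let ?g = "\<lambda>y. g y * indicator (pbox x (dil * r)) y"
  have pw: "mmax g y \<le> max (mmax ?g y) (ennreal F)" if "y \<in> pbox x r" for y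
  proof (rule mmax_le_local[OF r that])
    fix t assume "r < t"
    then have "(\<integral>\<^sup>+z\<in>pbox y t. g z \<partial>lebesgue) / vol y t \<le> ennreal ((C * D * B * m powr (\<kappa> - 1)) powr (1 / p))"
      by (intro average_le_of_large[OF _ B _ r _ that m]) (use g p1 in auto)
    also have "(C * D * B * m powr (\<kappa> - 1)) powr (1 / p) = F"
      using C B doubling_const_ge_1 by (simp add: p1 F_def)
    finally show "(\<integral>\<^sup>+z\<in>pbox y t. g z \<partial>lebesgue) / vol y t \<le> ennreal F" .
  qed
  show ?thesis
  proof (cases "l < F")
    case True
    have "wmeasure w {y\<in>pbox x r. ennreal l < mmax g y} \<le> wmeasure w (pbox x r)"
      by (intro wmeasure_mono) auto
    also have "\<dots> = ennreal m" by (rule m)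
    also have "\<dots> \<le> ennreal (C * D ^ 2 / l * B * m powr \<kappa>)"
    proof (rule ennreal_leI)
      have "m * l \<le> m * F" using True m by simp
      also have "\<dots> = C * D * B * m powr \<kappa>"
        using m by (simp add: F_def powr_diff)
      also have "\<dots> \<le> C * D ^ 2 * B * m powr \<kappa>"
        using C B doubling_const_ge_1 by (intro mult_right_mono mult_left_mono) (auto simp: power2_eq_square)
      finally show "m \<le> C * D ^ 2 / l * B * m powr \<kappa>"
        using l by (simp add: field_simps)
    qed
    finally show ?thesis by (simp only: rhs)
  next
    case False
    have "ennreal (l / C) < wmax w ?g y" if "y \<in> pbox x r" "ennreal l < mmax g y" for y
    proof -
      have "ennreal l < max (mmax ?g y) (ennreal F)"
        using that(2) pw[OF that(1)] by (rule less_le_trans)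
      moreover have "ennreal F \<le> ennreal l"
        using False by (intro ennreal_leI) auto
      ultimately have "ennreal l < mmax ?g y"
        by (auto simp: less_max_iff_disj)
      also have "\<dots> \<le> ennreal C * wmax w ?g y"
        by (rule mmax_le_wmax[OF p1]) measurable
      finally have "ennreal C * ennreal (l / C) < ennreal C * wmax w ?g y"
        using C l by (simp add: ennreal_mult[symmetric])
      then show ?thesis
        using mult_left_mono[of "wmax w ?g y" "ennreal (l / C)" "ennreal C"] by (meson linorder_not_less zero_le)
    qed
    then have "ennreal (l / C) * wmeasure w {y\<in>pbox x r. ennreal l < mmax g y} \<le>
        ennreal (l / C) * wmeasure w {y. ennreal (l / C) < wmax w ?g y}"
      by (intro mult_left_mono wmeasure_mono) auto
    also have "\<dots> \<le> ennreal D * (\<integral>\<^sup>+y. ?g y * ennreal (w y) \<partial>lebesgue)"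
      by (rule wmax_weak) measurable
    also have "(\<integral>\<^sup>+y. ?g y * ennreal (w y) \<partial>lebesgue) = (\<integral>\<^sup>+y\<in>pbox x (dil * r). (g y * ennreal (w y)) \<partial>lebesgue)"
      by (simp add: mult_ac)
    also have "ennreal D * \<dots> \<le> ennreal D * (ennreal B * ennpowr (wmeasure w (pbox x (dil * r))) \<kappa>)"
      using r dil_pos by (intro mult_left_mono g) auto
    also have "\<dots> \<le> ennreal D * (ennreal B * ennreal (D * m powr \<kappa>))"
      by (intro mult_left_mono ennpowr_wmeasure_dil_le r m) auto
    finally have "ennreal (C / l) * (ennreal (l / C) * wmeasure w {y\<in>pbox x r. ennreal l < mmax g y}) \<le>
        ennreal (C / l) * (ennreal D * (ennreal B * ennreal (D * m powr \<kappa>)))"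
      by (rule mult_left_mono) auto
    moreover have "ennreal (C / l) * ennreal (l / C) = 1"
      using C l by (simp add: ennreal_mult[symmetric])
    moreover have "ennreal (C / l) * (ennreal D * (ennreal B * ennreal (D * m powr \<kappa>))) = ennreal (C * D ^ 2 / l * B * m powr \<kappa>)"
      using C l B doubling_const_ge_1 by (simp add: ennreal_mult[symmetric] power2_eq_square mult_ac)
    ultimately show ?thesis
      by (simp only: rhs mult.assoc[symmetric] mult_1)
  qed
qed

end

section \<open>Passage from weights, Muckenhoupt classes and \<open>maximal\<close> to the abstract
  setting\<close>

lemma weight_wmeasure_compact_finite:
  assumes "weight w" "compact K" shows "wmeasure w K < \<infinity>"
proof -
  have "integrable lebesgue (\<lambda>x. indicator K x *\<^sub>R w x)"
    using assms by (auto simp: weight_def set_integrable_def)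
  then have "(\<integral>\<^sup>+x. ennreal (norm (indicator K x *\<^sub>R w x)) \<partial>lebesgue) < \<infinity>"
    by (simp add: integrable_iff_bounded)
  moreover have "wmeasure w K \<le> (\<integral>\<^sup>+x. ennreal (norm (indicator K x *\<^sub>R w x)) \<partial>lebesgue)"
    unfolding wmeasure_def by (intro nn_integral_mono) (auto simp: indicator_def intro!: ennreal_leI)
  ultimately show ?thesis by simp
qed

lemma measurable_emod [measurable]: "f \<in> borel_measurable M \<Longrightarrow> emod f \<in> borel_measurable M"
  unfolding emod_def[abs_def] by measurable

context anisotropy begin

lemma maximal_eq_mmax: "maximal a f x = enn2ereal (mmax (emod f) x)"
  by (simp add: maximal_def mmax_def)

lemma emod_maximal: "emod (maximal a f) = mmax (emod f)"
  by (simp add: emod_def fun_eq_iff maximal_eq_mmax abs_of_nonneg)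

lemma compact_subset_pbox:
  assumes "compact K" obtains t where "0 < t" "K \<subseteq> pbox 0 t"
proof -
  obtain b where b: "0 < b" "\<And>x. x \<in> K \<Longrightarrow> norm x \<le> b"
    using compact_imp_bounded[OF assms] by (auto simp: bounded_pos)
  \<comment> \<open>As for \<open>dil\<close>, the sum dominates each term, so every half-side is at
    least \<open>b\<close>.\<close>
  define t where "t = (\<Sum>i\<in>UNIV. b powr (1 / a $ i))"
  have "0 < t" unfolding t_def using b(1) by (intro sum_pos) auto
  moreover have b_le: "b \<le> t powr (a $ i)" for i
  proof -
    have "b = (b powr (1 / a $ i)) powr (a $ i)"
      using b(1) a_pos[of i] by (simp add: powr_powr)
    also have "\<dots> \<le> t powr (a $ i)"
      unfolding t_def using a_pos[of i] by (intro powr_mono2 member_le_sum) auto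
    finally show ?thesis .
  qed
  have "K \<subseteq> pbox 0 t"
  proof
    fix x assume "x \<in> K"
    then have "\<bar>x $ i\<bar> \<le> t powr (a $ i)" for i
      using b(2)[of x] component_le_norm_cart[of x i] b_le[of i] by linarith
    then show "x \<in> pbox 0 t" by (simp add: parallelepiped_def)
  qed
  ultimately show ?thesis by (rule that)
qed

text \<open>Finiteness of the dual mass has to be extracted from the condition: the mass of
  \<open>w\<close> on a box is positive, so an infinite dual mass would make the left-hand side
  infinite.\<close>

lemma dual_weights_if_muckenhoupt:
  assumes p: "1 < p" and w: "w \<in> muckenhoupt_A a p"
  obtains C where "dual_weights a p w (\<lambda>x. w x powr (1 - conjugate_exponent p)) C"
proof -
  let ?\<sigma> = "\<lambda>x. w x powr (1 - conjugate_exponent p)"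
  have weight: "weight w" using w by (simp add: muckenhoupt_A_def)
  then have [measurable]: "w \<in> borel_measurable lebesgue" and pos: "AE x in lebesgue. 0 < w x"
    by (auto simp: weight_def)
  obtain C where C: "1 < C" "\<And>x t. 0 < t \<Longrightarrow>
      wmeasure w (pbox x t) / vol x t * ennpowr (wmeasure ?\<sigma> (pbox x t) / vol x t) (p - 1) \<le> ennreal C"
    using w unfolding muckenhoupt_A_def parallelepipeds_def wmeasure_def[symmetric] by blast
  have fin: "wmeasure ?\<sigma> (pbox x t) < \<infinity> \<and>
      wmeasure w (pbox x t) * ennpowr (wmeasure ?\<sigma> (pbox x t)) (p - 1) \<le> ennreal C * ennpowr (vol x t) p"
    if t: "0 < t" for x t
  proof -
    obtain m where m: "wmeasure w (pbox x t) = ennreal m" "0 < m"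
      using weight_wmeasure_compact_finite[OF weight compact_pbox, of x t] wmeasure_pbox_pos[OF _ pos t, of x]
      by (cases "wmeasure w (pbox x t)") auto
    obtain V where V: "vol x t = ennreal V" "0 < V"
      using t by (simp add: vol_eq del: emeasure_completion)
    have Ap: "ennreal m / ennreal V * ennpowr (wmeasure ?\<sigma> (pbox x t) / ennreal V) (p - 1) \<le> ennreal C"
      using C(2)[OF t, of x] by (simp only: m V)
    show ?thesis
    proof (cases "wmeasure ?\<sigma> (pbox x t)")
      case (real s)
      have "m / V * (s / V) powr (p - 1) \<le> C"
        using Ap real m V C by (simp add: divide_ennreal ennreal_mult[symmetric])
      then have "m * s powr (p - 1) \<le> C * V powr p"
      proof -
        have "m / V * (s / V) powr (p - 1) = m * s powr (p - 1) / (V * V powr (p - 1))"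
          using V real by (simp add: powr_divide)
        moreover have "V * V powr (p - 1) = V powr p"
          using V by (simp add: powr_diff)
        ultimately show ?thesis
          using \<open>m / V * (s / V) powr (p - 1) \<le> C\<close> V by (simp add: pos_divide_le_eq)
      qed
      then show ?thesis
        using real m V C by (simp add: ennreal_mult[symmetric] del: emeasure_completion)
    next
      case top
      then have "ennreal m / ennreal V * ennpowr (wmeasure ?\<sigma> (pbox x t) / ennreal V) (p - 1) = top"
        using m V by (simp add: ennreal_top_divide ennreal_mult_top divide_ennreal)
      with Ap show ?thesis by (simp add: top_unique)
    qed
  qed
  have "dual_weights a p w ?\<sigma> C"
    by unfold_locales
      (use p pos fin C(1) weight_wmeasure_compact_finite[OF weight compact_pbox] in \<open>auto simp del: emeasure_completion\<close>)
  then show ?thesis by (rule that)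
qed

text \<open>A box lies in the dilated box about each of its points \<open>y\<close>, so for almost
  every such \<open>y\<close> its mass is at most a multiple of its volume times \<open>w y\<close>.
  Multiplying by \<open>g y\<close> and integrating over the box gives the averaging
  condition.\<close>

lemma averaging_if_muckenhoupt_A1:
  assumes w: "w \<in> muckenhoupt_A1 a"
  obtains C where "1 \<le> C" "averaging 1 w C"
proof -
  have weight: "weight w" using w by (simp add: muckenhoupt_A1_def)
  then have [measurable]: "w \<in> borel_measurable lebesgue" and pos: "AE x in lebesgue. 0 < w x"
    by (auto simp: weight_def)
  obtain C where C: "1 < C" "AE x in lebesgue. maximal a (\<lambda>y. ereal (w y)) x \<le> ereal (C * w x)"
    using w unfolding muckenhoupt_A1_def by blast
  \<comment> \<open>The extra factor is the volume ratio between the box of parameter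
    \<open>dil * t\<close> about \<open>y\<close> and the original box.\<close>
  define C' where "C' = C * dil powr hom_dim"
  have C': "0 < C'" using C(1) dil_pos by (simp add: C'_def)
  \<comment> \<open>The absolute value comes from \<open>emod\<close>; \<open>w\<close> is known to
    be positive only almost everywhere.\<close>
  have bound: "AE y in lebesgue. mmax (\<lambda>z. ennreal \<bar>w z\<bar>) y \<le> ennreal (C * w y)"
    using C(2) pos
  proof eventually_elim
    case (elim y)
    have "emod (\<lambda>y. ereal (w y)) = (\<lambda>z. ennreal \<bar>w z\<bar>)"
      by (simp add: emod_def fun_eq_iff)
    then have "enn2ereal (mmax (\<lambda>z. ennreal \<bar>w z\<bar>) y) \<le> ereal (C * w y)"
      using elim(1) by (simp add: maximal_eq_mmax)
    then show ?case
      using elim(2) C(1) by (cases "mmax (\<lambda>z. ennreal \<bar>w z\<bar>) y") (auto simp: ennreal_leI)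
  qed
  have "averaging 1 w C'"
    unfolding averaging_def
  proof (intro allI ballI impI)
    fix x and t :: real and g :: "real^'n \<Rightarrow> ennreal"
    assume [measurable]: "g \<in> borel_measurable lebesgue" and t: "0 < t"
    obtain V where V: "vol x t = ennreal V" "0 < V"
      using t by (simp add: vol_eq del: emeasure_completion)
    have A1: "AE y in lebesgue. y \<in> pbox x t \<longrightarrow> wmeasure w (pbox x t) \<le> ennreal (C' * V * w y)"
      using bound pos
    proof (eventually_elim, intro impI)
      fix y assume y: "mmax (\<lambda>z. ennreal \<bar>w z\<bar>) y \<le> ennreal (C * w y)" "0 < w y" "y \<in> pbox x t"
      have "y \<in> pbox y t \<inter> pbox x t" using y t center_mem_pbox by auto
      then have sub: "pbox x t \<subseteq> pbox y (dil * t)"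
        using t by (intro pbox_engulf) auto
      have dt: "0 < dil * t" using dil_pos t by simp
      have V': "vol y (dil * t) = ennreal (dil powr hom_dim * V)"
        unfolding vol_dil[OF t] using t V dil_pos
        by (simp add: ennreal_mult[symmetric] vol_eq del: emeasure_completion)
      have "wmeasure w (pbox x t) / vol y (dil * t) \<le> (\<integral>\<^sup>+z\<in>pbox y (dil * t). ennreal \<bar>w z\<bar> \<partial>lebesgue) / vol y (dil * t)"
        unfolding wmeasure_def using sub
        by (intro divide_right_mono_ennreal nn_integral_mono) (auto simp: indicator_def intro!: ennreal_leI)
      also have "\<dots> \<le> mmax (\<lambda>z. ennreal \<bar>w z\<bar>) y"
        unfolding mmax_def using dt by (intro SUP_upper) auto
      also have "\<dots> \<le> ennreal (C * w y)" by (rule y)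
      finally have "wmeasure w (pbox x t) / vol y (dil * t) * vol y (dil * t) \<le> ennreal (C * w y) * vol y (dil * t)"
        by (rule mult_right_mono) auto
      also have "wmeasure w (pbox x t) / vol y (dil * t) * vol y (dil * t) = wmeasure w (pbox x t)"
        unfolding V' using V dil_pos by (intro ennreal_divide_times_cancel) auto
      finally show "wmeasure w (pbox x t) \<le> ennreal (C' * V * w y)"
        unfolding V' C'_def using C(1) y(2) V dil_pos by (simp add: ennreal_mult[symmetric] mult_ac)
    qed
    have "wmeasure w (pbox x t) * (\<integral>\<^sup>+y\<in>pbox x t. g y \<partial>lebesgue) = (\<integral>\<^sup>+y. wmeasure w (pbox x t) * (g y * indicator (pbox x t) y) \<partial>lebesgue)"
      by (rule nn_integral_cmult[symmetric]) measurable
    also have "\<dots> \<le> (\<integral>\<^sup>+y. ennreal (C' * V) * (g y * ennreal (w y) * indicator (pbox x t) y) \<partial>lebesgue)"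
      using A1 pos
    proof (intro nn_integral_mono_AE, eventually_elim)
      fix y assume y: "y \<in> pbox x t \<longrightarrow> wmeasure w (pbox x t) \<le> ennreal (C' * V * w y)" "0 < w y"
      show "wmeasure w (pbox x t) * (g y * indicator (pbox x t) y) \<le> ennreal (C' * V) * (g y * ennreal (w y) * indicator (pbox x t) y)"
      proof (cases "y \<in> pbox x t")
        case True
        then have "wmeasure w (pbox x t) * g y \<le> ennreal (C' * V * w y) * g y"
          using y by (intro mult_right_mono) auto
        also have "\<dots> = ennreal (C' * V) * (g y * ennreal (w y))"
          using y C' V by (simp add: ennreal_mult mult_ac)
        finally show ?thesis using True by simp
      qed simp
    qed
    also have "\<dots> = ennreal (C' * V) * (\<integral>\<^sup>+y\<in>pbox x t. (g y * ennreal (w y)) \<partial>lebesgue)"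
      by (rule nn_integral_cmult) measurable
    finally show "wmeasure w (pbox x t) * ennpowr (\<integral>\<^sup>+y\<in>pbox x t. g y \<partial>lebesgue) 1 \<le>
        ennreal C' * ennpowr (vol x t) 1 * (\<integral>\<^sup>+y\<in>pbox x t. (ennpowr (g y) 1 * ennreal (w y)) \<partial>lebesgue)"
      using C' V by (simp add: ennreal_mult del: emeasure_completion)
  qed
  moreover have "1 \<le> C'"
    unfolding C'_def using C(1) dil_gt_1 a_pos
    by (intro mult_ge1_I[of C "dil powr hom_dim"] ge_one_powr_ge_zero) (auto simp: hom_dim_def less_imp_le intro!: sum_nonneg)
  ultimately show ?thesis by (rule that[rotated])
qed

section \<open>Strong and weak type estimates on Morrey spaces\<close>

lemma morrey_strong_type:
  assumes \<kappa>: "0 < \<kappa>" "\<kappa> < 1" and p: "1 < p" and w: "w \<in> muckenhoupt_A a p"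
  shows "\<exists>C>0. \<forall>f\<in>morrey_space a p \<kappa> w. maximal a f \<in> morrey_space a p \<kappa> w \<and>
    morrey_norm a p \<kappa> w (maximal a f) \<le> ennreal C * morrey_norm a p \<kappa> w f"
proof -
  obtain C where "dual_weights a p w (\<lambda>x. w x powr (1 - conjugate_exponent p)) C"
    by (rule dual_weights_if_muckenhoupt[OF p w])
  then interpret DW: dual_weights a p w "\<lambda>x. w x powr (1 - conjugate_exponent p)" C .
  define D where "D = max 1 (C * dil powr (hom_dim * p))"
  interpret W: averaging_weight a w D p \<kappa> C
    unfolding averaging_weight_def averaging_weight_axioms_def D_def
    using DW.doubling_w DW.averaging DW.w_pos DW.C \<kappa> p by auto
  obtain K where K: "0 < K" "\<And>g. g \<in> borel_measurable lebesgue \<Longrightarrow>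
    (\<integral>\<^sup>+x. ennpowr (mmax g x) p * ennreal (w x) \<partial>lebesgue) \<le> ennreal K * (\<integral>\<^sup>+x. ennpowr (g x) p * ennreal (w x) \<partial>lebesgue)"
    by (rule DW.mmax_strong) blast
  \<comment> \<open>The integral estimate concerns p-th powers, so the constant for norms is a p-th
    root.\<close>
  define L where "L = (K * D + C * D) powr (1 / p)"
  have CD: "1 \<le> C" "1 \<le> D" by (auto simp: D_def DW.C)
  have KCD: "0 < K * D + C * D" using K(1) CD by (intro add_pos_pos) auto
  then have L: "0 < L" "L powr p = K * D + C * D" using p by (auto simp: L_def powr_powr)
  show ?thesis
  proof (intro exI[of _ L] conjI ballI L(1))
    fix f assume f: "f \<in> morrey_space a p \<kappa> w"
    then have [measurable]: "f \<in> borel_measurable lebesgue" and "morrey_norm a p \<kappa> w f < \<infinity>"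
      by (auto simp: morrey_space_def)
    then obtain N where N: "morrey_norm a p \<kappa> w f = ennreal N" "0 \<le> N"
      by (cases "morrey_norm a p \<kappa> w f") auto
    have est: "(\<integral>\<^sup>+y\<in>pbox x t. (ennpowr (mmax (emod f) y) p * ennreal (w y)) \<partial>lebesgue)
      \<le> ennreal ((L * N) powr p) * ennpowr (wmeasure w (pbox x t)) \<kappa>" if "0 < t" for x t
    proof -
      have "\<forall>x t. 0 < t \<longrightarrow> (\<integral>\<^sup>+y\<in>pbox x t. (ennpowr (emod f y) p * ennreal (w y)) \<partial>lebesgue)
        \<le> ennreal (N powr p) * ennpowr (wmeasure w (pbox x t)) \<kappa>"
        using W.morrey_norm_le_iff[OF N(2), of f] N by simp
      then have "(\<integral>\<^sup>+y\<in>pbox x t. (ennpowr (mmax (emod f) y) p * ennreal (w y)) \<partial>lebesgue)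
          \<le> ennreal ((K * D + C * D) * N powr p) * ennpowr (wmeasure w (pbox x t)) \<kappa>"
        using K that by (intro W.mmax_morrey_strong) auto
      then show ?thesis
        using L N by (simp add: powr_mult)
    qed
    then have "morrey_norm a p \<kappa> w (maximal a f) \<le> ennreal (L * N)"
      using L N by (subst W.morrey_norm_le_iff) (auto simp: emod_maximal)
    also have "\<dots> = ennreal L * morrey_norm a p \<kappa> w f"
      using L N by (simp add: ennreal_mult)
    finally show le: "morrey_norm a p \<kappa> w (maximal a f) \<le> ennreal L * morrey_norm a p \<kappa> w f" .
    have "(\<integral>\<^sup>+x\<in>S. (emod (maximal a f) x * ennreal (w x)) \<partial>lebesgue) < \<infinity>" if S: "compact S" for S
    proof -
      \<comment> \<open>Local integrability against \<open>w\<close> concerns the first power. On a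
        box containing \<open>S\<close> it is dominated by 1 plus the p-th power, and both have
        finite weighted integrals there.\<close>
      obtain t where t: "0 < t" "S \<subseteq> pbox 0 t" by (rule compact_subset_pbox[OF S])
      have le: "z \<le> 1 + ennpowr z p" for z
      proof (cases z)
        case (real r)
        have "r \<le> 1 + r powr p"
          using p real powr_mono[of 1 p r] by (cases "r \<le> 1") (auto intro: add_increasing2)
        then show ?thesis
          using real by (simp flip: ennreal_1 ennreal_plus)
      qed simp
      have "(\<integral>\<^sup>+x\<in>S. (emod (maximal a f) x * ennreal (w x)) \<partial>lebesgue) \<le>
          (\<integral>\<^sup>+x. ennreal (w x) * indicator (pbox 0 t) x + ennpowr (mmax (emod f) x) p * ennreal (w x) * indicator (pbox 0 t) x \<partial>lebesgue)"
      proof (rule nn_integral_mono)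
        fix x
        have "mmax (emod f) x * ennreal (w x) \<le> (1 + ennpowr (mmax (emod f) x) p) * ennreal (w x)"
          using le by (rule mult_right_mono) auto
        then show "emod (maximal a f) x * ennreal (w x) * indicator S x \<le>
            ennreal (w x) * indicator (pbox 0 t) x + ennpowr (mmax (emod f) x) p * ennreal (w x) * indicator (pbox 0 t) x"
          using t(2) by (auto simp: emod_maximal distrib_right indicator_def)
      qed
      also have "\<dots> = wmeasure w (pbox 0 t) + (\<integral>\<^sup>+x\<in>pbox 0 t. (ennpowr (mmax (emod f) x) p * ennreal (w x)) \<partial>lebesgue)"
        unfolding wmeasure_def by (rule nn_integral_add) measurable
      also have "\<dots> < \<infinity>"
      proof -
        obtain m where m: "wmeasure w (pbox 0 t) = ennreal m" "0 < m" by (rule W.obtain_mass[OF t(1)])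
        have "(\<integral>\<^sup>+x\<in>pbox 0 t. (ennpowr (mmax (emod f) x) p * ennreal (w x)) \<partial>lebesgue) < \<infinity>"
          by (rule le_less_trans[OF est[OF t(1)]]) (use m in \<open>simp add: ennreal_mult[symmetric]\<close>)
        then show ?thesis using m by simp
      qed
      finally show ?thesis .
    qed
    moreover have "maximal a f \<in> borel_measurable lebesgue"
      unfolding maximal_eq_mmax[abs_def] by measurable
    moreover have "morrey_norm a p \<kappa> w (maximal a f) < \<infinity>"
      by (rule le_less_trans[OF le]) (use N L in \<open>simp add: ennreal_mult[symmetric]\<close>)
    ultimately show "maximal a f \<in> morrey_space a p \<kappa> w"
      by (simp add: morrey_space_def)
  qed
qed

lemma morrey_weak_type:
  assumes \<kappa>: "0 < \<kappa>" "\<kappa> < 1" and w: "w \<in> muckenhoupt_A1 a"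
  shows "\<exists>C>0. \<forall>f\<in>morrey_space a 1 \<kappa> w. \<forall>t>0. \<forall>E\<in>parallelepipeds a.
    wmeasure w {x\<in>E. maximal a f x > ereal t}
      \<le> ennreal (C / t) * morrey_norm a 1 \<kappa> w f * ennpowr (wmeasure w E) \<kappa>"
proof -
  have weight: "weight w" using w by (simp add: muckenhoupt_A1_def)
  obtain C where C: "1 \<le> C" "averaging 1 w C" by (rule averaging_if_muckenhoupt_A1[OF w])
  define D where "D = max 1 (C * dil powr (hom_dim * 1))"
  have "doubling_weight a w D"
    unfolding D_def using weight C weight_wmeasure_compact_finite[OF weight compact_pbox]
    by (intro doubling_weight_if_averaging) (auto simp: weight_def)
  then interpret W: averaging_weight a w D 1 \<kappa> C
    unfolding averaging_weight_def averaging_weight_axioms_def using C \<kappa> weight by (auto simp: weight_def)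
  have D: "1 \<le> D" by (simp add: D_def)
  show ?thesis
  proof (intro exI[of _ "C * D ^ 2"] conjI ballI allI impI)
    show "0 < C * D ^ 2" using C D by simp
  next
    fix f t E assume f: "f \<in> morrey_space a 1 \<kappa> w" and t: "0 < (t :: real)" and "E \<in> parallelepipeds a"
    then obtain x r where E: "E = pbox x r" "0 < r" by (auto simp: parallelepipeds_def)
    have [measurable]: "f \<in> borel_measurable lebesgue" and "morrey_norm a 1 \<kappa> w f < \<infinity>"
      using f by (auto simp: morrey_space_def)
    then obtain N where N: "morrey_norm a 1 \<kappa> w f = ennreal N" "0 \<le> N"
      by (cases "morrey_norm a 1 \<kappa> w f") auto
    have "\<forall>x t. 0 < t \<longrightarrow> (\<integral>\<^sup>+y\<in>pbox x t. (emod f y * ennreal (w y)) \<partial>lebesgue)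
        \<le> ennreal N * ennpowr (wmeasure w (pbox x t)) \<kappa>"
      using W.morrey_norm_le_iff[OF N(2), of f] N by simp
    then have "wmeasure w {y\<in>pbox x r. ennreal t < mmax (emod f) y}
        \<le> ennreal (C * D ^ 2 / t) * ennreal N * ennpowr (wmeasure w (pbox x r)) \<kappa>"
      using N E t by (intro W.mmax_morrey_weak) auto
    moreover have "ereal t < maximal a f y \<longleftrightarrow> ennreal t < mmax (emod f) y" for y
      using t by (cases "mmax (emod f) y") (auto simp: maximal_eq_mmax ennreal_less_iff)
    ultimately show "wmeasure w {x\<in>E. maximal a f x > ereal t}
        \<le> ennreal (C * D ^ 2 / t) * morrey_norm a 1 \<kappa> w f * ennpowr (wmeasure w E) \<kappa>"
      by (simp add: E N)
  qed
qed

end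

theorem theorem3:
  fixes a :: "real^'n" and \<kappa> :: real
  assumes "\<forall>i. 0 < a $ i" and "0 < \<kappa>" and "\<kappa> < 1"
  shows "(\<forall>p w. 1 < p \<longrightarrow> w \<in> muckenhoupt_A a p \<longrightarrow>
            (\<exists>C>0. \<forall>f\<in>morrey_space a p \<kappa> w.
               maximal a f \<in> morrey_space a p \<kappa> w \<and>
               morrey_norm a p \<kappa> w (maximal a f) \<le> ennreal C * morrey_norm a p \<kappa> w f)) \<and>
         (\<forall>w\<in>muckenhoupt_A1 a.
            \<exists>C>0. \<forall>f\<in>morrey_space a 1 \<kappa> w. \<forall>t>0. \<forall>E\<in>parallelepipeds a.
               wmeasure w {x\<in>E. maximal a f x > ereal t}
                 \<le> ennreal (C / t) * morrey_norm a 1 \<kappa> w f * ennpowr (wmeasure w E) \<kappa>)"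
proof -
  interpret anisotropy a by unfold_locales (use assms in auto)
  show ?thesis
    using morrey_strong_type[OF assms(2,3)] morrey_weak_type[OF assms(2,3)] by blast
qed

end
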